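(* Let $\mathcal{A}$ be a sign pattern of order $n$. Suppose $A=[a_{ij}]\in Q(\mathcal{A})$ is a matrix having refined inertia $(0,0,c_1,c_2)$ with $c_1\geq 2$, and $A$ allows a full-rank Jacobian. Suppose that for some index $k\in\{1,\dots,n\}$ and some index $v\in\{1,\dots,n\}$ with $v\neq k$ we have $a_{kk}\neq 0$, $a_{kv}\neq 0$ and $\det A(k,v)\neq 0$. Let $B$ be the matrix of order $n+1$ $$B=\left[\begin{array}{c|c} A-a_{kk}P_{kk} & \mathbf{e}_k\\ \hline a_{kk}\, r_k(A-a_{kk}P_{kk}) & a_{kk}\end{array}\right].$$ Then $B$ has refined inertia $(0,0,c_1+1,c_2)$, $B$ allows a full-rank Jacobian, and every superpattern of $\mathcal{B}=\operatorname{sgn}(B)$ is inertially arbitrary.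
   Context: All matrices are real. A sign pattern of order $n$ is an $n\times n$ matrix $\mathcal{A}=[\alpha_{ij}]$ with entries in $\{0,+,-\}$. $Q(\mathcal{A})$ is the set of real $n\times n$ matrices $A=[a_{ij}]$ with $a_{ij}=0$ if $\alpha_{ij}=0$, $a_{ij}>0$ if $\alpha_{ij}=+$, and $a_{ij}<0$ if $\alpha_{ij}=-$. If $A\in Q(\mathcal{A})$, write $\operatorname{sgn}(A)=\mathcal{A}$. A pattern $\mathcal{B}=[\beta_{ij}]$ is a superpattern of $\mathcal{A}=[\alpha_{ij}]$ (of the same order) if $\alpha_{ij}\neq 0$ implies $\beta_{ij}=\alpha_{ij}$. The inertia of a matrix $A$ is the triple $i(A)=(a,b,c)$, where $a$, $b$, $c$ are the numbers of eigenvalues of $A$ (counted with algebraic multiplicity) with positive, negative and zero real part, respectively. The refined inertia of $A$ is the $4$-tuple $(a,b,c_1,c_2)$, where $c_1$ is the algebraic multiplicity of zero as an eigenvalue of $A$ and $c_1+c_2=c$ (so $c_2$ is the number of nonzero purely imaginary eigenvalues). A sign pattern $\mathcal{A}$ of order $n$ is inertially arbitrary if for every triple of nonnegative integers $(a,b,c)$ with $a+b+c=n$ there is a matrix $A\in Q(\mathcal{A})$ with $i(A)=(a,b,c)$. Full-rank Jacobian: let $A$ be a matrix of order $n$. Choose $m\ge n$ nonzero entries $a_{i_1j_1},\dots,a_{i_mj_m}$ of $A$ and let $X=X_A(x_1,\dots,x_m)$ be obtained from $A$ by replacing $a_{i_kj_k}$ with a variable $x_k$ for $k=1,\dots,m$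 (all other entries are kept fixed). Write the characteristic polynomial $\det(zI-X)=z^n+f_1z^{n-1}+\cdots+f_{n-1}z+f_n$ with $f_i=f_i(x_1,\dots,x_m)$, and let $J_{X=A}$ be the $n\times m$ matrix with $(i,j)$ entry $\partial f_i/\partial x_j$ evaluated at $(x_1,\dots,x_m)=(a_{i_1j_1},\dots,a_{i_mj_m})$. A matrix $A$ with refined inertia $(0,0,c_1,c_2)$ allows a full-rank Jacobian if, for some such choice of entries, $J_{X=A}$ has rank $n$. Notation: $r_k(M)$ is the $k$th row of $M$; $P_{kk}$ is the $n\times n$ matrix with a $1$ in entry $(k,k)$ and zeros elsewhere; $\mathbf{e}_k\in\mathbb{R}^n$ is the $k$th standard unit column vector; $A(u,v)$ is the matrix obtained from $A$ by deleting row $u$ and column $v$. *)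

theory Defs
  imports
    "HOL-Analysis.Derivative"
    "Jordan_Normal_Form.Char_Poly"
    "Jordan_Normal_Form.DL_Rank"
begin

datatype sign = SZero | SPos | SNeg

definition sign_of :: "real \<Rightarrow> sign" where
  "sign_of x = (if x = 0 then SZero else if x > 0 then SPos else SNeg)"

definition sgn_mat :: "real mat \<Rightarrow> sign mat" where
  "sgn_mat A = map_mat sign_of A"

definition pattern_class :: "sign mat \<Rightarrow> real mat set" where
  "pattern_class S =
     {A \<in> carrier_mat (dim_row S) (dim_col S).
        \<forall>i < dim_row S. \<forall>j < dim_col S.
          (S $$ (i, j) = SZero \<longrightarrow> A $$ (i, j) = 0) \<and>
          (S $$ (i, j) = SPos \<longrightarrow> A $$ (i, j) > 0) \<and>
          (S $$ (i, j) = SNeg \<longrightarrow> A $$ (i, j) < 0)}"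

text \<open>\<open>superpattern T S\<close> means that \<open>T\<close> is a superpattern of \<open>S\<close>.\<close>
definition superpattern :: "sign mat \<Rightarrow> sign mat \<Rightarrow> bool" where
  "superpattern T S \<longleftrightarrow>
     T \<in> carrier_mat (dim_row S) (dim_col S) \<and>
     (\<forall>i < dim_row S. \<forall>j < dim_col S. S $$ (i, j) \<noteq> SZero \<longrightarrow> T $$ (i, j) = S $$ (i, j))"

definition eigenvalues :: "real mat \<Rightarrow> complex multiset" where
  "eigenvalues A = proots (char_poly (map_mat complex_of_real A))"

definition inertia :: "real mat \<Rightarrow> nat \<times> nat \<times> nat" where
  "inertia A =
     (size {# z \<in># eigenvalues A. Re z > 0 #},
      size {# z \<in># eigenvalues A. Re z < 0 #},
      size {# z \<in># eigenvalues A. Re z = 0 #})"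

definition refined_inertia :: "real mat \<Rightarrow> nat \<times> nat \<times> nat \<times> nat" where
  "refined_inertia A =
     (size {# z \<in># eigenvalues A. Re z > 0 #},
      size {# z \<in># eigenvalues A. Re z < 0 #},
      count (eigenvalues A) 0,
      size {# z \<in># eigenvalues A. Re z = 0 \<and> z \<noteq> 0 #})"

definition inertially_arbitrary :: "sign mat \<Rightarrow> bool" where
  "inertially_arbitrary S \<longleftrightarrow>
     square_mat S \<and>
     (\<forall>a b c. a + b + c = dim_row S \<longrightarrow> (\<exists>A \<in> pattern_class S. inertia A = (a, b, c)))"

text \<open>The chosen entries are given by a list \<open>ps\<close> of distinct positions; \<open>replace_entries A ps xs\<close>
  is the matrix \<open>X\<^sub>A(x\<^sub>1, \<dots>, x\<^sub>m)\<close>, where \<open>xs\<close> has the same length as \<open>ps\<close>.\<close>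
definition replace_entries :: "real mat \<Rightarrow> (nat \<times> nat) list \<Rightarrow> real list \<Rightarrow> real mat" where
  "replace_entries A ps xs =
     mat (dim_row A) (dim_col A)
       (\<lambda>p. case map_of (zip ps xs) p of None \<Rightarrow> A $$ p | Some x \<Rightarrow> x)"

text \<open>The coefficient \<open>f\<^sub>i\<close> of \<open>z ^ (n - i)\<close> in the characteristic polynomial, for
  \<open>1 \<le> i \<le> n\<close>.\<close>
definition char_coeff :: "real mat \<Rightarrow> (nat \<times> nat) list \<Rightarrow> nat \<Rightarrow> real list \<Rightarrow> real" where
  "char_coeff A ps i xs = coeff (char_poly (replace_entries A ps xs)) (dim_row A - i)"

text \<open>Rows are indexed from 0, so row \<open>i\<close> belongs to \<open>f\<^bsub>i+1\<^esub>\<close>.\<close>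
definition jacobian :: "real mat \<Rightarrow> (nat \<times> nat) list \<Rightarrow> real mat" where
  "jacobian A ps =
     (let as = map (\<lambda>p. A $$ p) ps in
      mat (dim_row A) (length ps)
        (\<lambda>(i, j). deriv (\<lambda>t. char_coeff A ps (i + 1) (as[j := t])) (as ! j)))"

definition allows_full_rank_jacobian :: "real mat \<Rightarrow> bool" where
  "allows_full_rank_jacobian A \<longleftrightarrow>
     square_mat A \<and>
     (\<exists>ps. distinct ps \<and> length ps \<ge> dim_row A \<and>
           (\<forall>(i, j) \<in> set ps. i < dim_row A \<and> j < dim_col A \<and> A $$ (i, j) \<noteq> 0) \<and>
           vec_space.rank (dim_row A) (jacobian A ps) = dim_row A)"

definition diag_unit_mat :: "nat \<Rightarrow> nat \<Rightarrow> real mat" where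
  "diag_unit_mat n k = mat n n (\<lambda>(i, j). if i = k \<and> j = k then 1 else 0)"

definition bordered_mat :: "real mat \<Rightarrow> nat \<Rightarrow> real mat" where
  "bordered_mat A k =
     (let n = dim_row A;
          a = A $$ (k, k);
          A' = A - a \<cdot>\<^sub>m diag_unit_mat n k
      in four_block_mat
           A'                                 (mat_of_cols n [unit_vec n k])
           (mat_of_rows n [a \<cdot>\<^sub>v row A' k])   (mat_of_rows 1 [vec 1 (\<lambda>_. a)]))"

end

theory Submission
  imports Defs "HOL-Analysis.Function_Topology"
begin

text \<open>
  Everything rests on one formula: the derivative of the characteristic polynomial of \<open>A\<close> with
  respect to the entry at \<open>(i, j)\<close> is minus the \<open>(i, j)\<close> cofactor of \<open>z I - A\<close>. Hence \<open>A\<close> allows a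
  full-rank Jacobian iff the cofactors of \<open>z I - A\<close> at the nonzero positions of \<open>A\<close> span all
  polynomials of degree less than \<open>n\<close> (\<open>allows_full_rank_jacobian_iff\<close>).

  Write \<open>a = a\<^sub>k\<^sub>k\<close>. The bordered matrix is \<open>B = L\<^sup>-\<^sup>1 M L\<close>, where \<open>M\<close> has the block rows \<open>[A, e\<^sub>k]\<close> and
  \<open>[0, 0]\<close>, and \<open>L\<close> differs from the identity only by the entry \<open>- a\<close> in the last row, in column \<open>k\<close>.
  So the characteristic polynomial of \<open>B\<close> is \<open>z\<close> times that of \<open>A\<close>, which gives the refined
  inertia. The same factorization computes the adjugate of \<open>z I - B\<close>. Each product of \<open>z\<close> with a
  cofactor of \<open>z I - A\<close> at a nonzero position of \<open>A\<close> is a combination of cofactors of \<open>z I - B\<close> at nonzero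
  positions of \<open>B\<close>, so all multiples of \<open>z\<close> of degree at most \<open>n\<close> are in the span. The cofactor at
  position \<open>(n, v)\<close> has constant term \<open>\<plusminus>det A(k, v) \<noteq> 0\<close>, and this
  fills the one missing dimension (\<open>cofactors_span_bordered_mat\<close>).

  For the superpatterns, give the extra entries of the superpattern a small nonzero size and vary
  the nonzero entries of \<open>B\<close> along directions that move one coefficient each to first order. The
  coefficient map is then close to the identity, and a contraction argument shows that every monic
  polynomial close to that of \<open>B\<close> is attained (\<open>char_polys_near_attained_in_superpattern\<close>).
  It remains to find, arbitrarily close to a monic polynomial with only imaginary roots, real
  polynomials of each inertia. A conjugate pair can only move as a pair, but zero is a root of
  multiplicity at least two, and its copies move independently. This is enough freedom to repair
  every parity (\<open>imaginary_poly_perturbation\<close>).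
\<close>

hide_const (open) Module.smult

section \<open>Perturbing polynomials with purely imaginary roots\<close>

abbreviation complex_roots :: "real poly \<Rightarrow> complex multiset" where
  "complex_roots p \<equiv> proots (map_poly complex_of_real p)"

definition root_inertia :: "complex multiset \<Rightarrow> nat \<times> nat \<times> nat" where
  "root_inertia R =
     (size {# z \<in># R. Re z > 0 #}, size {# z \<in># R. Re z < 0 #}, size {# z \<in># R. Re z = 0 #})"

lemma root_inertia_add:
  assumes "root_inertia R = (a, b, c)" and "root_inertia R' = (a', b', c')"
  shows "root_inertia (R + R') = (a + a', b + b', c + c')"
  using assms by (simp add: root_inertia_def)

lemma map_poly_of_real_mult:
  "map_poly complex_of_real (p * q) = map_poly complex_of_real p * map_poly complex_of_real q"
proof -
  interpret map_poly_comm_ring_hom complex_of_real ..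
  show ?thesis by (rule hom_mult)
qed

lemma map_poly_of_real_eq_0 [simp]: "map_poly complex_of_real p = 0 \<longleftrightarrow> p = 0"
  by (simp add: map_poly_eq_0_iff)

lemma complex_roots_mult:
  "p \<noteq> 0 \<Longrightarrow> q \<noteq> 0 \<Longrightarrow> complex_roots (p * q) = complex_roots p + complex_roots q"
  by (simp add: map_poly_of_real_mult proots_mult)

lemma complex_roots_linear: "complex_roots [:- x, 1:] = {# complex_of_real x #}"
proof -
  have "map_poly complex_of_real [:- x, 1:] = [:- complex_of_real x, 1:]" by simp
  then show ?thesis by (simp only: proots_linear_factor) simp
qed

lemma map_poly_of_real_power:
  "map_poly complex_of_real (p ^ m) = map_poly complex_of_real p ^ m"
  by (induction m) (simp_all add: map_poly_of_real_mult)

lemma complex_roots_power: "complex_roots (p ^ m) = repeat_mset m (complex_roots p)"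
  by (simp add: map_poly_of_real_power proots_power)

lemma filter_mset_replicate_mset:
  "filter_mset P (replicate_mset m x) = (if P x then replicate_mset m x else {#})"
  by (induction m) auto

text \<open>The monic real quadratic with the roots \<open>s \<plusminus> w \<i>\<close>.\<close>
definition conjugate_factor :: "real \<Rightarrow> real \<Rightarrow> real poly" where
  "conjugate_factor s w = [: s\<^sup>2 + w\<^sup>2, - 2 * s, 1 :]"

lemma conjugate_factor_simps [simp]:
  "degree (conjugate_factor s w) = 2" "coeff (conjugate_factor s w) 2 = 1" "conjugate_factor s w \<noteq> 0"
  by (simp_all add: conjugate_factor_def numeral_2_eq_2)

lemma complex_roots_conjugate_factor:
  "complex_roots (conjugate_factor s w) = {# Complex s w, Complex s (- w) #}"
proof -
  have "map_poly complex_of_real (conjugate_factor s w)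
      = [:- Complex s w, 1:] * [:- Complex s (- w), 1:]"
    by (simp add: conjugate_factor_def complex_eq_iff power2_eq_square)
  then show ?thesis by (simp del: mult_pCons_left mult_pCons_right add: proots_mult)
qed

text \<open>Division with remainder by the real quadratic leaves a remainder of degree at most one, and a real
  polynomial of degree at most one that vanishes at a nonreal point is zero.\<close>
lemma conjugate_factor_dvd:
  assumes "poly (map_poly complex_of_real p) (Complex 0 w) = 0" and "w \<noteq> 0"
  shows "conjugate_factor 0 w dvd p"
proof -
  let ?d = "conjugate_factor 0 w"
  define r where "r = p mod ?d"
  have p: "p = ?d * (p div ?d) + r" by (simp add: r_def)
  have "poly (map_poly complex_of_real ?d) (Complex 0 w) = 0"
    by (simp add: conjugate_factor_def complex_eq_iff power2_eq_square)
  then have "poly (map_poly complex_of_real r) (Complex 0 w) = 0"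
    using assms(1) arg_cong[OF p, of "\<lambda>p. poly (map_poly complex_of_real p) (Complex 0 w)"]
    by (simp add: map_poly_of_real_mult hom_distribs)
  moreover have "degree r < 2" using degree_mod_less'[of ?d p] unfolding r_def by (cases "p mod ?d = 0") auto
  then obtain r0 r1 where r: "r = [:r0, r1:]"
    by (metis One_nat_def degree1_coeffs degree_eq_zeroE less_2_cases pCons_0_0 numeral_2_eq_2)
  ultimately have "r0 = 0" "r1 = 0" using assms(2) by (auto simp: complex_eq_iff hom_distribs)
  then show ?thesis using p r by (metis add.right_neutral dvd_triv_left pCons_0_0)
qed

text \<open>Convergence of all coefficients. The limits along which it is used are \<open>at_right 0\<close> for one-parameter
  families of polynomials and a filter of shrinking pairs of parameter vectors for matrix families.\<close>
definition coeffs_tendsto :: "('a \<Rightarrow> real poly) \<Rightarrow> real poly \<Rightarrow> 'a filter \<Rightarrow> bool" where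
  "coeffs_tendsto q p F \<longleftrightarrow> (\<forall>i. ((\<lambda>w. coeff (q w) i) \<longlongrightarrow> coeff p i) F)"

lemma coeffs_tendsto_const: "coeffs_tendsto (\<lambda>w. p) p F"
  by (simp add: coeffs_tendsto_def)

lemma coeffs_tendsto_mult:
  "coeffs_tendsto q p F \<Longrightarrow> coeffs_tendsto q' p' F \<Longrightarrow> coeffs_tendsto (\<lambda>w. q w * q' w) (p * p') F"
  by (auto simp: coeffs_tendsto_def coeff_mult intro!: tendsto_intros)

lemma coeffs_tendsto_power: "coeffs_tendsto q p F \<Longrightarrow> coeffs_tendsto (\<lambda>w. q w ^ m) (p ^ m) F"
  by (induction m) (auto intro: coeffs_tendsto_mult coeffs_tendsto_const)

lemma coeffs_tendsto_sum:
  "(\<And>x. x \<in> I \<Longrightarrow> coeffs_tendsto (q x) (p x) F) \<Longrightarrow> coeffs_tendsto (\<lambda>w. \<Sum>x\<in>I. q x w) (\<Sum>x\<in>I. p x) F"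
  by (auto simp: coeffs_tendsto_def coeff_sum intro!: tendsto_intros)

lemma coeffs_tendsto_prod:
  "(\<And>x. x \<in> I \<Longrightarrow> coeffs_tendsto (q x) (p x) F) \<Longrightarrow> coeffs_tendsto (\<lambda>w. \<Prod>x\<in>I. q x w) (\<Prod>x\<in>I. p x) F"
  by (induction I rule: infinite_finite_induct) (auto intro: coeffs_tendsto_mult coeffs_tendsto_const)

lemma coeffs_tendsto_pCons:
  assumes "(f \<longlongrightarrow> a) F" "coeffs_tendsto q p F"
  shows "coeffs_tendsto (\<lambda>w. pCons (f w) (q w)) (pCons a p) F"
  using assms by (auto simp: coeffs_tendsto_def coeff_pCons split: nat.split)

lemma monic_imaginary_roots_cases:
  fixes p :: "real poly"
  assumes "monic p" and im: "\<And>z. poly (map_poly complex_of_real p) z = 0 \<Longrightarrow> Re z = 0"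
  obtains (zero) "p = [:0, 1:] ^ degree p"
  | (pair) w p' where "w \<noteq> 0" "p = conjugate_factor 0 w * p'"
proof (cases "\<exists>z. poly (map_poly complex_of_real p) z = 0 \<and> z \<noteq> 0")
  case True
  then obtain z where z: "poly (map_poly complex_of_real p) z = 0" "z \<noteq> 0" by auto
  then have "z = Complex 0 (Im z)" "Im z \<noteq> 0" using im[OF z(1)] by (auto simp: complex_eq_iff)
  with z conjugate_factor_dvd[of p "Im z"] pair show thesis by (metis dvdE)
next
  case False
  have "p \<noteq> 0" using assms(1) by auto
  then obtain g where g: "p = [:- 0, 1:] ^ Polynomial.order 0 p * g" "\<not> [:- 0, 1:] dvd g" using order_decomp by blast
  have "constant (poly (map_poly complex_of_real g))"
  proof (rule ccontr)
    assume "\<not> ?thesis"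
    then obtain z where z: "poly (map_poly complex_of_real g) z = 0"
      using fundamental_theorem_of_algebra by blast
    then have "poly (map_poly complex_of_real p) z = 0"
      using arg_cong[OF g(1), of "\<lambda>p. poly (map_poly complex_of_real p) z"] by (simp add: map_poly_of_real_mult)
    with False have "z = 0" by blast
    with z have "poly g 0 = 0" by (simp add: poly_0_coeff_0 coeff_map_poly)
    with g(2) show False by (simp add: poly_eq_0_iff_dvd)
  qed
  then have "degree g = 0" by (simp add: constant_degree)
  then obtain c where c: "g = [:c:]" by (rule degree_eq_zeroE)
  have "c = 1" using assms(1) g(1) c \<open>p \<noteq> 0\<close>
    by (metis lead_coeff_mult lead_coeff_pCons(2) lead_coeff_power mult_1 one_pCons lead_coeff_1 power_one pCons_0_0 lead_coeff_pCons(1) one_neq_zero)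
  with g c have "p = [:0, 1:] ^ Polynomial.order 0 p" by simp
  moreover have "degree p = Polynomial.order 0 p" using calculation by (metis degree_linear_power minus_zero)
  ultimately show thesis using zero by simp
qed

text \<open>Induction that splits off one conjugate pair at a time. While a pair is left, the degree is at
  least four, so one of \<open>a\<close>, \<open>b\<close>, \<open>c\<close> is at least two: move the pair to the corresponding half
  plane, or leave it on the imaginary axis, and continue with the other factor. Once only the root
  zero is left, its copies can be moved along the real axis independently. The hypothesis on
  \<open>[:0, 1:]\<^sup>2\<close> keeps the degree large enough for this pigeonhole step.\<close>
lemma imaginary_poly_perturbation:
  fixes p :: "real poly"
  assumes "monic p" and "\<And>z. poly (map_poly complex_of_real p) z = 0 \<Longrightarrow> Re z = 0"
    and "[:0, 1:]\<^sup>2 dvd p" and "a + b + c = degree p"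
  shows "\<exists>q :: real \<Rightarrow> real poly. coeffs_tendsto q p (at_right 0) \<and>
    (\<forall>e>0. monic (q e) \<and> degree (q e) = degree p \<and> root_inertia (complex_roots (q e)) = (a, b, c))"
  using assms
proof (induction "degree p" arbitrary: p a b c rule: less_induct)
  case less
  consider (zero) "p = [:0, 1:] ^ degree p"
    | (pair) w p' where "w \<noteq> 0" "p = conjugate_factor 0 w * p'"
    using monic_imaginary_roots_cases less.prems(1,2) by blast
  then show ?case
  proof cases
    case zero
    define q where "q = (\<lambda>e::real. [:- e, 1:] ^ a * [:e, 1:] ^ b * [:0, 1:] ^ c)"
    have "coeffs_tendsto q ([:- 0, 1:] ^ a * [:0, 1:] ^ b * [:0, 1:] ^ c) (at_right 0)"
      unfolding q_def
      by (intro coeffs_tendsto_mult coeffs_tendsto_power coeffs_tendsto_pCons coeffs_tendsto_const tendsto_intros)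
    moreover have "[:- 0, 1:] ^ a * [:0, 1:] ^ b * [:0, 1:] ^ c = p"
      using zero less.prems(4) by (metis minus_zero power_add)
    ultimately have "coeffs_tendsto q p (at_right 0)" by simp
    moreover have "monic (q e) \<and> degree (q e) = degree p \<and> root_inertia (complex_roots (q e)) = (a, b, c)"
      if "e > 0" for e
    proof -
      have "monic (q e)" unfolding q_def by (intro monic_mult monic_power) auto
      moreover have "degree (q e) = a + b + c"
        unfolding q_def by (simp add: degree_mult_eq degree_linear_power degree_power_eq)
      moreover have "complex_roots (q e) = repeat_mset a {# complex_of_real e #}
          + repeat_mset b {# complex_of_real (- e) #} + repeat_mset c {# 0 #}"
        unfolding q_def
        using complex_roots_linear[of e] complex_roots_linear[of "- e"] complex_roots_linear[of 0]
        by (simp add: complex_roots_mult complex_roots_power)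
      ultimately show ?thesis using that less.prems(4)
        by (simp add: root_inertia_def filter_mset_replicate_mset)
    qed
    ultimately show ?thesis by blast
  next
    case (pair w p')
    have p': "p' \<noteq> 0" "monic p'" "degree p = degree p' + 2"
    proof -
      show "p' \<noteq> 0" using less.prems(1) pair by auto
      then show "degree p = degree p' + 2" by (simp add: pair(2) degree_mult_eq)
      have "lead_coeff (conjugate_factor 0 w * p') = lead_coeff p'"
        by (subst lead_coeff_mult) simp
      then show "monic p'" using less.prems(1) unfolding pair(2) by simp
    qed
    \<comment> \<open>The quadratic does not vanish at zero, so both factors \<open>z\<close> of \<open>p\<close> pass to \<open>p'\<close>.\<close>
    have X_dvd: "[:0, 1:] dvd u" if "[:0, 1:] * g = conjugate_factor 0 w * u" for g u
    proof -
      have "poly u 0 = 0" using arg_cong[OF that, of "\<lambda>p. poly p 0"] pair(1) by (simp add: conjugate_factor_def)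
      then show ?thesis by (simp add: poly_eq_0_iff_dvd)
    qed
    obtain g where g: "[:0, 1:] * ([:0, 1:] * g) = conjugate_factor 0 w * p'"
      using less.prems(3) unfolding pair(2) by (metis dvdE power2_eq_square mult.assoc)
    obtain u where u: "p' = [:0, 1:] * u" using X_dvd[OF g] by (rule dvdE)
    have "[:0, 1:] * ([:0, 1:] * g) = [:0, 1:] * (conjugate_factor 0 w * u)"
      using g unfolding u by (simp only: mult.left_commute)
    then have "[:0, 1:] * g = conjugate_factor 0 w * u" by (rule mult_left_cancel[THEN iffD1, rotated]) simp
    then have "[:0, 1:] dvd u" by (rule X_dvd)
    then have "[:0, 1:]\<^sup>2 dvd p'" unfolding u power2_eq_square by (rule mult_dvd_mono[OF dvd_refl])
    moreover from this have "degree p' \<ge> 2"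
      using dvd_imp_degree_le[OF _ p'(1), of "[:0,1:]\<^sup>2"] by (simp add: degree_power_eq)
    \<comment> \<open>Since \<open>p\<close> has degree at least four, one of three numbers with this sum is at least two.\<close>
    then have "a \<ge> 2 \<or> b \<ge> 2 \<or> c \<ge> 2" using less.prems(4) p'(3) by linarith
    \<comment> \<open>The sign \<open>s\<close> is the direction in which the real part of the pair moves.\<close>
    then obtain a' b' c' s where s: "a' + b' + c' = degree p'"
      "\<And>e::real. e > 0 \<Longrightarrow> root_inertia {# Complex (s * e) w, Complex (s * e) (- w) #} = (a - a', b - b', c - c')"
      "a' \<le> a" "b' \<le> b" "c' \<le> c"
    proof (elim disjE, goal_cases)
      case 1
      then show ?case using 1(1)[of "a - 2" b c 1] less.prems(4) p'(3) by (simp add: root_inertia_def)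
    next
      case 2
      then show ?case using 2(1)[of a "b - 2" c "- 1"] less.prems(4) p'(3) by (simp add: root_inertia_def)
    next
      case 3
      then show ?case using 3(1)[of a b "c - 2" 0] less.prems(4) p'(3) by (simp add: root_inertia_def)
    qed
    have "poly (map_poly complex_of_real p') z = 0 \<Longrightarrow> Re z = 0" for z
      using less.prems(2)[of z] by (simp add: pair map_poly_of_real_mult)
    ultimately obtain q :: "real \<Rightarrow> real poly" where q: "coeffs_tendsto q p' (at_right 0)"
      "\<And>e. e > 0 \<Longrightarrow> monic (q e) \<and> degree (q e) = degree p' \<and> root_inertia (complex_roots (q e)) = (a', b', c')"
      using less.hyps[of p' a' b' c'] p' s(1) by auto
    define Q where "Q = (\<lambda>e. conjugate_factor (s * e) w * q e)"
    have "coeffs_tendsto (\<lambda>e. conjugate_factor (s * e) w) (conjugate_factor (s * 0) w) (at_right 0)"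
      unfolding conjugate_factor_def
      by (intro coeffs_tendsto_pCons coeffs_tendsto_const tendsto_intros)
    then have "coeffs_tendsto Q p (at_right 0)" unfolding Q_def pair(2) using coeffs_tendsto_mult q(1) by fastforce
    moreover have "monic (Q e) \<and> degree (Q e) = degree p \<and> root_inertia (complex_roots (Q e)) = (a, b, c)"
      if e: "e > 0" for e
    proof -
      have nz: "conjugate_factor (s * e) w \<noteq> 0" "q e \<noteq> 0" using q(2)[OF e] by auto
      have "monic (Q e)" unfolding Q_def using q(2)[OF e] by (intro monic_mult) auto
      moreover have "degree (Q e) = degree p" unfolding Q_def
        using nz q(2)[OF e] p'(3) by (simp add: degree_mult_eq)
      moreover have "root_inertia (complex_roots (Q e)) = (a, b, c)"
        using root_inertia_add[OF s(2)[OF e], of "complex_roots (q e)"] q(2)[OF e] s(3-5)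
        unfolding Q_def complex_roots_mult[OF nz] complex_roots_conjugate_factor by simp
      ultimately show ?thesis by simp
    qed
    ultimately show ?thesis by blast
  qed
qed

section \<open>Full-rank Jacobians and cofactors of the characteristic matrix\<close>

text \<open>Rank is the dimension of the column space; a column space of dimension \<open>n\<close> contains \<open>n\<close> independent
  columns and these form a basis.\<close>
lemma (in vec_space) full_row_rank_iff_surjective:
  assumes M: "M \<in> carrier_mat n m"
  shows "rank M = n \<longleftrightarrow> (\<forall>w \<in> carrier_vec n. \<exists>x \<in> carrier_vec m. M *\<^sub>v x = w)"
proof -
  have cols: "set (cols M) \<subseteq> carrier_vec n" using M cols_dim by blast
  have "rank M = n \<longleftrightarrow> span (set (cols M)) = carrier_vec n"
  proof
    assume r: "rank M = n"
    obtain U where U: "maximal U (\<lambda>T. T \<subseteq> set (cols M) \<and> lin_indpt T)"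
      using maximal_exists_superset[of "set (cols M)" "\<lambda>T. T \<subseteq> set (cols M) \<and> lin_indpt T" "{}"]
      by (auto simp: lin_dep_def)
    then have "U \<subseteq> set (cols M)" "lin_indpt U" by (auto simp: maximal_def)
    moreover have "card U = n" using rank_card_indpt[OF M U] r by simp
    moreover have "finite U" using calculation(1) finite_subset by blast
    ultimately have "basis U"
      using dim_li_is_basis[OF fin_dim, of U] dim_is_n cols by auto
    then have "carrier_vec n = span U" by (simp add: basis_def)
    also have "\<dots> \<subseteq> span (set (cols M))" using \<open>U \<subseteq> _\<close> by (rule span_is_monotone)
    finally show "span (set (cols M)) = carrier_vec n"
      using span_closed[OF cols] by auto
  next
    assume s: "span (set (cols M)) = carrier_vec n"
    then have "span_vs (set (cols M)) = V" by simp
    then show "rank M = n" unfolding rank_def using dim_is_n by simp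
  qed
  also have "span (set (cols M)) = {y \<in> carrier_vec n. \<exists>x \<in> carrier_vec m. M *\<^sub>v x = y}"
    using col_space_eq[OF M] M by (simp add: col_space_def)
  finally show ?thesis by auto
qed

definition update_entry :: "real mat \<Rightarrow> nat \<times> nat \<Rightarrow> real \<Rightarrow> real mat" where
  "update_entry A p t = mat (dim_row A) (dim_col A) (\<lambda>q. if q = p then t else A $$ q)"

lemma update_entry_carrier [simp]: "A \<in> carrier_mat n m \<Longrightarrow> update_entry A p t \<in> carrier_mat n m"
  by (auto simp: update_entry_def)

text \<open>The negated derivative of the characteristic polynomial with respect to the entry at \<open>p\<close>.\<close>
definition char_cofactor :: "real mat \<Rightarrow> nat \<times> nat \<Rightarrow> real poly" where
  "char_cofactor A p = cofactor (char_poly_matrix A) (fst p) (snd p)"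

lemma char_cofactor_update_entry:
  assumes "A \<in> carrier_mat n n" "i < n" "j < n" "l < n"
  shows "char_cofactor (update_entry A (i, j) t) (i, l) = char_cofactor A (i, l)"
proof -
  have "mat_delete (char_poly_matrix (update_entry A (i, j) t)) i l = mat_delete (char_poly_matrix A) i l"
    using assms by (intro eq_matI) (auto simp: mat_delete_def char_poly_matrix_def update_entry_def)
  then show ?thesis by (simp add: char_cofactor_def cofactor_def)
qed

text \<open>Expansion of the determinant along the row of \<open>p\<close>: the cofactors of that row do not contain the
  entries of the row, so the characteristic polynomial is affine in each single entry.\<close>
lemma char_poly_update_entry:
  assumes A: "A \<in> carrier_mat n n" and p: "fst p < n" "snd p < n"
  shows "char_poly (update_entry A p t) = char_poly A - smult (t - A $$ p) (char_cofactor A p)"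
proof -
  obtain i j where ij: "p = (i, j)" "i < n" "j < n" using p by (cases p) auto
  let ?U = "update_entry A p t"
  have row: "char_poly M = (\<Sum>l<n. char_poly_matrix M $$ (i, l) * char_cofactor M (i, l))"
    if "M \<in> carrier_mat n n" for M
    using laplace_expansion_row[OF char_poly_matrix_closed[OF that] ij(2)] by (simp add: char_poly_def char_cofactor_def)
  have "char_poly_matrix ?U $$ (i, l) * char_cofactor ?U (i, l)
     = char_poly_matrix A $$ (i, l) * char_cofactor A (i, l)
       - (if l = j then smult (t - A $$ p) (char_cofactor A p) else 0)" if "l < n" for l
    using char_cofactor_update_entry[OF A ij(2,3) that, of t] A ij that
    by (auto simp: char_poly_matrix_def update_entry_def algebra_simps smult_diff_left)
  then have "char_poly ?U = (\<Sum>l<n. char_poly_matrix A $$ (i, l) * char_cofactor A (i, l)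
       - (if l = j then smult (t - A $$ p) (char_cofactor A p) else 0))"
    using row[of ?U] A by simp
  also have "\<dots> = char_poly A - smult (t - A $$ p) (char_cofactor A p)"
    using row[OF A] ij(3) by (simp add: sum_subtractf sum.delta)
  finally show ?thesis .
qed

text \<open>The cofactor is the difference of two characteristic polynomials, both monic of degree \<open>n\<close>.\<close>
lemma degree_char_cofactor:
  assumes A: "A \<in> carrier_mat n n" and p: "fst p < n" "snd p < n"
  shows "degree (char_cofactor A p) < n"
proof -
  let ?U = "update_entry A p (A $$ p - 1)"
  have c: "char_cofactor A p = char_poly ?U - char_poly A" using char_poly_update_entry[OF A p] by simp
  have "degree (char_cofactor A p) \<le> n" "coeff (char_cofactor A p) n = 0" unfolding c
    using degree_monic_char_poly[of ?U n] degree_monic_char_poly[OF A] A degree_diff_le[of "char_poly ?U" n "char_poly A"] by auto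
  then show ?thesis using p by (cases "degree (char_cofactor A p) = n") auto
qed

definition nonzero_positions :: "real mat \<Rightarrow> (nat \<times> nat) set" where
  "nonzero_positions A = {p. fst p < dim_row A \<and> snd p < dim_col A \<and> A $$ p \<noteq> 0}"

lemma finite_nonzero_positions [simp]: "finite (nonzero_positions A)"
  by (rule finite_subset[of _ "{..<dim_row A} \<times> {..<dim_col A}"]) (auto simp: nonzero_positions_def)

definition cofactor_combination :: "real mat \<Rightarrow> (nat \<times> nat \<Rightarrow> real) \<Rightarrow> real poly" where
  "cofactor_combination A h = (\<Sum>p \<in> nonzero_positions A. smult (h p) (char_cofactor A p))"

text \<open>Full rank of the Jacobian without a choice of positions: surjectivity of the derivative of the
  characteristic polynomial along all directions supported on the nonzero positions.\<close>
definition cofactors_span :: "real mat \<Rightarrow> bool" where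
  "cofactors_span A \<longleftrightarrow> (\<forall>r. degree r < dim_row A \<longrightarrow> r \<in> range (cofactor_combination A))"

lemma jacobian_entry:
  assumes A: "A \<in> carrier_mat n n" and ps: "distinct ps" "set ps \<subseteq> nonzero_positions A"
    and ij: "i < n" "j < length ps"
  shows "jacobian A ps $$ (i, j) = - coeff (char_cofactor A (ps ! j)) (n - Suc i)"
proof -
  let ?as = "map (\<lambda>p. A $$ p) ps" and ?p = "ps ! j"
  have p: "fst ?p < n" "snd ?p < n" using ps(2) ij(2) A by (auto simp: nonzero_positions_def dest: nth_mem)
  have "replace_entries A ps (?as[j := t]) = update_entry A ?p t" for t
  proof -
    have "(case map_of (zip ps (?as[j := t])) q of None \<Rightarrow> A $$ q | Some x \<Rightarrow> x)
        = (if q = ?p then t else A $$ q)" for q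
    proof (cases "q \<in> set ps")
      case True
      then obtain l where "l < length ps" "q = ps ! l" by (metis in_set_conv_nth)
      then show ?thesis using ps(1) ij(2) map_of_zip_nth[of ps "?as[j := t]" l]
        by (auto simp: nth_list_update nth_eq_iff_index_eq)
    next
      case False
      then have "map_of (zip ps (?as[j := t])) q = None" by simp
      moreover have "q \<noteq> ?p" using False ij(2) by auto
      ultimately show ?thesis by (simp only: option.case if_False)
    qed
    then show ?thesis by (simp add: replace_entries_def update_entry_def)
  qed
  then have "(\<lambda>t. char_coeff A ps (i + 1) (?as[j := t]))
      = (\<lambda>t. coeff (char_poly A) (n - Suc i) - (t - A $$ ?p) * coeff (char_cofactor A ?p) (n - Suc i))"
    using char_poly_update_entry[OF A p] A by (auto simp: char_coeff_def)
  moreover have "((\<lambda>t. coeff (char_poly A) (n - Suc i) - (t - A $$ ?p) * coeff (char_cofactor A ?p) (n - Suc i))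
      has_field_derivative - coeff (char_cofactor A ?p) (n - Suc i)) (at x)" for x
    by (auto intro!: derivative_eq_intros)
  ultimately show ?thesis using ij A by (simp add: jacobian_def Let_def DERIV_imp_deriv)
qed

text \<open>Columns of the Jacobian are the coefficient vectors of the negated cofactors. A choice of
  positions with full rank stays of full rank when all nonzero positions are chosen.\<close>
lemma allows_full_rank_jacobian_iff:
  assumes A: "A \<in> carrier_mat n n"
  shows "allows_full_rank_jacobian A \<longleftrightarrow> cofactors_span A"
proof -
  interpret vec_space "TYPE(real)" n .
  have jac: "jacobian A ps \<in> carrier_mat n (length ps)" for ps using A by (auto simp: jacobian_def Let_def)
  have pos: "fst p < n \<and> snd p < n" if "p \<in> nonzero_positions A" for p
    using that A by (auto simp: nonzero_positions_def)
  have deg: "degree (char_cofactor A p) < n" if "p \<in> nonzero_positions A" for p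
    using that pos[of p] degree_char_cofactor[OF A] by simp
  \<comment> \<open>Signs and order follow the rows of the Jacobian: row \<open>i\<close> belongs to \<open>z ^ (n - 1 - i)\<close>.\<close>
  define w where "w r = vec n (\<lambda>i. - coeff r (n - Suc i))" for r :: "real poly"
  have w_inj: "r = r'" if "w r = w r'" "degree r < n" "degree r' < n" for r r' :: "real poly"
  proof (rule poly_eqI)
    fix l
    show "coeff r l = coeff r' l"
    proof (cases "l < n")
      case True
      have "w r $ (n - Suc l) = w r' $ (n - Suc l)" using that(1) by simp
      then show ?thesis using True by (simp add: w_def)
    qed (use that in \<open>simp add: coeff_eq_0\<close>)
  qed
  have jac_mult: "jacobian A ps *\<^sub>v x = w (\<Sum>j<length ps. smult (x $ j) (char_cofactor A (ps ! j)))"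
    if ps: "distinct ps" "set ps \<subseteq> nonzero_positions A" and x: "x \<in> carrier_vec (length ps)" for ps x
    using jac[of ps] x
    by (intro eq_vecI) (auto simp: w_def jacobian_entry[OF A ps] scalar_prod_def coeff_sum
        atLeast0LessThan mult.commute sum_negf)
  show ?thesis
  proof
    assume "allows_full_rank_jacobian A"
    then obtain ps where ps: "distinct ps" "set ps \<subseteq> nonzero_positions A"
      and rank: "rank (jacobian A ps) = n"
      using A unfolding allows_full_rank_jacobian_def by (fastforce simp: nonzero_positions_def)
    show "cofactors_span A" unfolding cofactors_span_def
    proof (intro allI impI)
      fix r :: "real poly" assume r: "degree r < dim_row A"
      obtain x where x: "x \<in> carrier_vec (length ps)" "jacobian A ps *\<^sub>v x = w r"
        using full_row_rank_iff_surjective[OF jac] rank by (metis vec_carrier w_def)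
      \<comment> \<open>Reindex the coordinates of \<open>x\<close> by positions; positions outside \<open>ps\<close> get the weight zero.\<close>
      define h where "h p = (if p \<in> set ps then x $ (THE j. j < length ps \<and> ps ! j = p) else 0)" for p
      have h: "h (ps ! j) = x $ j" if "j < length ps" for j
        using that ps(1) nth_mem[OF that] unfolding h_def
        by (auto intro!: arg_cong[of _ _ "\<lambda>j. x $ j"] the_equality simp: nth_eq_iff_index_eq)
      have "cofactor_combination A h = (\<Sum>p\<in>set ps. smult (h p) (char_cofactor A p))"
        unfolding cofactor_combination_def using ps(2) by (intro sum.mono_neutral_right) (auto simp: h_def)
      also have "\<dots> = (\<Sum>j<length ps. smult (h (ps ! j)) (char_cofactor A (ps ! j)))"
        using ps(1) by (simp add: sum.distinct_set_conv_list interv_sum_list_conv_sum_set_nat sum_list_sum_nth atLeast0LessThan)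
      also have "\<dots> = (\<Sum>j<length ps. smult (x $ j) (char_cofactor A (ps ! j)))" using h by simp
      also have "\<dots> = r"
      proof (rule w_inj)
        show "w (\<Sum>j<length ps. smult (x $ j) (char_cofactor A (ps ! j))) = w r"
          using jac_mult[OF ps x(1)] x(2) by simp
        show "degree r < n" using r A by simp
        then show "degree (\<Sum>j<length ps. smult (x $ j) (char_cofactor A (ps ! j))) < n"
          using deg[OF subsetD[OF ps(2) nth_mem]]
            by (intro degree_sum_less) (auto intro: le_less_trans[OF degree_smult_le])
      qed
      finally show "r \<in> range (cofactor_combination A)" by blast
    qed
  next
    assume span: "cofactors_span A"
    obtain ps where ps: "distinct ps" "set ps = nonzero_positions A"
      using finite_distinct_list[OF finite_nonzero_positions] by blast
    have "\<exists>x\<in>carrier_vec (length ps). jacobian A ps *\<^sub>v x = v" if v: "v \<in> carrier_vec n" for v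
    proof (cases "n = 0")
      case True
      then show ?thesis using v jac[of ps] by (intro bexI[of _ "0\<^sub>v (length ps)"]) auto
    next
      case False
      define r where "r = (\<Sum>l<n. monom (- v $ (n - Suc l)) l)"
      have "degree r < n" unfolding r_def using False
        by (intro degree_sum_less) (auto intro: le_less_trans[OF degree_monom_le])
      then obtain h where h: "r = cofactor_combination A h" using span A by (auto simp: cofactors_span_def)
      have "w r = v" using v by (intro eq_vecI) (auto simp: w_def r_def coeff_sum coeff_monom)
      moreover have "r = (\<Sum>j<length ps. smult (vec (length ps) (\<lambda>j. h (ps ! j)) $ j) (char_cofactor A (ps ! j)))"
        unfolding h cofactor_combination_def ps(2)[symmetric]
        using ps(1) by (simp add: sum.distinct_set_conv_list sum_list_sum_nth atLeast0LessThan)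
      ultimately show ?thesis using jac_mult[OF ps(1)] ps(2)
        by (metis order_refl vec_carrier)
    qed
    then have "rank (jacobian A ps) = n" using full_row_rank_iff_surjective[OF jac] by blast
    moreover from this have "length ps \<ge> n" using rank_le_nc[OF jac[of ps]] by simp
    ultimately show "allows_full_rank_jacobian A"
      unfolding allows_full_rank_jacobian_def using A ps by (fastforce simp: nonzero_positions_def)
  qed
qed

section \<open>Characteristic matrix of the bordered matrix\<close>

text \<open>Over an integral domain a right inverse up to the factor \<open>det M \<noteq> 0\<close> determines the adjugate, which
  spares the computation of the minors of a block matrix.\<close>
lemma adj_mat_unique:
  fixes M Y :: "'a :: idom mat"
  assumes M: "M \<in> carrier_mat n n" and Y: "Y \<in> carrier_mat n n"
    and MY: "M * Y = det M \<cdot>\<^sub>m 1\<^sub>m n" and "det M \<noteq> 0"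
  shows "Y = adj_mat M"
proof -
  have adj: "adj_mat M \<in> carrier_mat n n" using adj_mat(1)[OF M] .
  have "det M \<cdot>\<^sub>m Y = (adj_mat M * M) * Y" using adj_mat(3)[OF M] Y
    by (simp add: mult_smult_assoc_mat[OF one_carrier_mat Y])
  also have "\<dots> = adj_mat M * (det M \<cdot>\<^sub>m 1\<^sub>m n)" using assoc_mult_mat[OF adj M Y] MY by simp
  also have "\<dots> = det M \<cdot>\<^sub>m adj_mat M" using adj by (simp add: mult_smult_distrib[OF adj one_carrier_mat])
  finally have eq: "det M \<cdot>\<^sub>m Y = det M \<cdot>\<^sub>m adj_mat M" .
  show ?thesis
  proof (rule eq_matI)
    fix i j assume ij: "i < dim_row (adj_mat M)" "j < dim_col (adj_mat M)"
    then have "(det M \<cdot>\<^sub>m Y) $$ (i, j) = (det M \<cdot>\<^sub>m adj_mat M) $$ (i, j)" using eq by simp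
    then show "Y $$ (i, j) = adj_mat M $$ (i, j)" using ij Y adj \<open>det M \<noteq> 0\<close> by auto
  qed (use adj Y in auto)
qed

context
  fixes A :: "real mat" and n k :: nat
  assumes A: "A \<in> carrier_mat n n" and k: "k < n"
begin

private abbreviation (input) "a \<equiv> A $$ (k, k)"
private abbreviation (input) "X \<equiv> [:0, 1:] :: real poly"
private abbreviation (input) "C \<equiv> char_poly_matrix A"
private abbreviation (input) "N \<equiv> adj_mat C"
private abbreviation (input) "B \<equiv> bordered_mat A k"

text \<open>\<open>shear a\<close> and \<open>shear (- a)\<close> are the matrices \<open>L\<^sup>-\<^sup>1\<close> and \<open>L\<close> of the similarity that carries
  the block matrix with rows \<open>[A, e\<^sub>k]\<close> and \<open>[0, 0]\<close> to the bordered matrix.\<close>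
private definition shear :: "real \<Rightarrow> real poly mat" where
  "shear t = four_block_mat (1\<^sub>m n) (0\<^sub>m n 1) (mat 1 n (\<lambda>(_, j). if j = k then [:t:] else 0)) (1\<^sub>m 1)"

text \<open>The characteristic matrix of the block matrix with rows \<open>[A, e\<^sub>k]\<close> and \<open>[0, 0]\<close>; the matrix
  \<open>core_adj\<close> is its adjugate.\<close>
private definition "core = four_block_mat C (mat n 1 (\<lambda>(i, _). if i = k then - 1 else 0)) (0\<^sub>m 1 n) (mat 1 1 (\<lambda>_. X))"

private definition "core_adj =
  four_block_mat (X \<cdot>\<^sub>m N) (mat n 1 (\<lambda>(i, _). N $$ (i, k))) (0\<^sub>m 1 n) (mat 1 1 (\<lambda>_. char_poly A))"

lemma bordered_mat_carrier: "B \<in> carrier_mat (Suc n) (Suc n)"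
  using A by (intro carrier_matI) (auto simp: bordered_mat_def Let_def diag_unit_mat_def)

lemma bordered_mat_entry:
  assumes "i \<le> n" "j \<le> n"
  shows "B $$ (i, j) =
    (if i < n then if j < n then if i = k \<and> j = k then 0 else A $$ (i, j) else if i = k then 1 else 0
     else if j < n then if j = k then 0 else a * A $$ (k, j) else a)"
  using assms A k unfolding bordered_mat_def Let_def
  by (auto simp: diag_unit_mat_def mat_of_cols_def mat_of_rows_def unit_vec_def)

private lemma C_carrier: "C \<in> carrier_mat n n" "N \<in> carrier_mat n n"
  using char_poly_matrix_closed[OF A] adj_mat(1)[OF char_poly_matrix_closed[OF A]] by auto

private lemma shear_carrier: "shear t \<in> carrier_mat (Suc n) (Suc n)"
  using four_block_carrier_mat[OF one_carrier_mat[of n] one_carrier_mat[of 1]] by (auto simp: shear_def)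

private lemma core_carrier: "core \<in> carrier_mat (Suc n) (Suc n)" "core_adj \<in> carrier_mat (Suc n) (Suc n)"
  using C_carrier by (auto simp: core_def core_adj_def)

private lemma row_mult:
  assumes "M \<in> carrier_mat n m"
  shows "mat 1 n (\<lambda>(_, j). if j = k then [:t:] else 0) * M = mat 1 m (\<lambda>(_, j). smult t (M $$ (k, j)))"
  using assms k
  by (intro eq_matI) (auto simp: scalar_prod_def sum.delta if_distrib[of "\<lambda>x. x * _"] cong: if_cong)

private lemma mult_row:
  assumes "M \<in> carrier_mat m 1"
  shows "M * mat 1 n (\<lambda>(_, j). if j = k then [:t:] else 0)
    = mat m n (\<lambda>(i, j). if j = k then smult t (M $$ (i, 0)) else (0 :: real poly))"
  using assms by (intro eq_matI) (auto simp: scalar_prod_def mult.commute)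

private lemma shear_mult_four_block:
  fixes P :: "real poly mat"
  assumes M: "P \<in> carrier_mat n n" "Q \<in> carrier_mat n 1" "R \<in> carrier_mat 1 n" "T \<in> carrier_mat 1 1"
  shows "shear t * four_block_mat P Q R T
    = four_block_mat P Q (mat 1 n (\<lambda>(_, j). smult t (P $$ (k, j))) + R) (mat 1 1 (\<lambda>(_, j). smult t (Q $$ (k, j))) + T)"
  unfolding shear_def
  by (subst mult_four_block_mat[OF _ _ _ _ M]) (use M in \<open>auto simp: row_mult simp del: One_nat_def\<close>)

private lemma four_block_mult_shear:
  fixes P :: "real poly mat"
  assumes M: "P \<in> carrier_mat n n" "Q \<in> carrier_mat n 1" "R \<in> carrier_mat 1 n" "T \<in> carrier_mat 1 1"
  shows "four_block_mat P Q R T * shear t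
    = four_block_mat (P + mat n n (\<lambda>(i, j). if j = k then smult t (Q $$ (i, 0)) else 0)) Q
        (R + mat 1 n (\<lambda>(i, j). if j = k then smult t (T $$ (i, 0)) else 0)) T"
  unfolding shear_def
  by (subst mult_four_block_mat[OF M]) (use M in \<open>auto simp: mult_row simp del: One_nat_def\<close>)

private lemma shear_inverse: "shear s * shear (- s) = 1\<^sub>m (Suc n)"
proof -
  have "shear s * shear (- s) = four_block_mat (1\<^sub>m n) (0\<^sub>m n 1) (0\<^sub>m 1 n) (1\<^sub>m 1)"
    unfolding shear_def[of "- s"]
    by (subst shear_mult_four_block) (use k in \<open>auto intro!: cong_four_block_mat eq_matI\<close>)
  then show ?thesis by simp
qed

private lemma char_poly_matrix_bordered: "char_poly_matrix B = shear a * core * shear (- a)"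
proof -
  have *: "shear a * core * shear (- a) = four_block_mat
     (C + mat n n (\<lambda>(i, j). if j = k then smult (- a) (if i = k then - 1 else 0) else 0))
     (mat n 1 (\<lambda>(i, _). if i = k then - 1 else 0))
     (mat 1 n (\<lambda>(_, j). smult a (C $$ (k, j)) - (if j = k then smult a (X - [:a:]) else 0)))
     (mat 1 1 (\<lambda>_. X - [:a:]))"
    using C_carrier k unfolding core_def
    by (subst shear_mult_four_block, (auto)[4], subst four_block_mult_shear)
       (auto intro!: cong_four_block_mat eq_matI)
  show ?thesis unfolding *
    using bordered_mat_carrier C_carrier A k bordered_mat_entry
    by (intro eq_matI) (auto simp: char_poly_matrix_def)
qed

private lemma det_core: "det core = X * char_poly A"
proof -
  have "det core = det C * det (mat 1 1 (\<lambda>_. X))"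
    unfolding core_def using C_carrier by (intro det_four_block_mat_lower_left_zero) auto
  then show ?thesis by (simp add: det_single char_poly_def mult.commute)
qed

lemma char_poly_bordered_mat: "char_poly B = X * char_poly A"
proof -
  have unimodular: "det (shear a) * det (shear (- a)) = 1"
    using det_mult[OF shear_carrier shear_carrier] shear_inverse by (metis det_one)
  have "det (shear a * core * shear (- a)) = det (shear a) * det core * det (shear (- a))"
    using shear_carrier core_carrier by (metis det_mult mult_carrier_mat)
  then have "char_poly B = det (shear a) * (X * char_poly A) * det (shear (- a))"
    unfolding char_poly_def[of B] char_poly_matrix_bordered det_core .
  also have "\<dots> = (det (shear a) * det (shear (- a))) * (X * char_poly A)" by (simp only: ac_simps)
  finally show ?thesis unfolding unimodular by (simp only: mult_1)
qed

private lemma core_mult_core_adj: "core * core_adj = (X * char_poly A) \<cdot>\<^sub>m 1\<^sub>m (Suc n)"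
proof -
  let ?e = "mat n 1 (\<lambda>(i, _). if i = k then - 1 else 0) :: real poly mat"
  have CN: "C * N = char_poly A \<cdot>\<^sub>m 1\<^sub>m n" using adj_mat(2)[OF C_carrier(1)] by (simp add: char_poly_def)
  have col: "C * mat n 1 (\<lambda>(i, _). N $$ (i, k)) + ?e * mat 1 1 (\<lambda>_. char_poly A) = 0\<^sub>m n 1" (is "?l = _")
  proof (rule eq_matI)
    fix i j assume "i < dim_row (0\<^sub>m n 1 :: real poly mat)" "j < dim_col (0\<^sub>m n 1 :: real poly mat)"
    then have ij: "i < n" "j = 0" by auto
    have "?l $$ (i, j) = (C * N) $$ (i, k) + (if i = k then - char_poly A else 0)"
      using C_carrier k ij by (auto simp: scalar_prod_def)
    then show "?l $$ (i, j) = 0\<^sub>m n 1 $$ (i, j)" unfolding CN using ij k by auto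
  qed (use C_carrier in auto)
  have "core * core_adj = four_block_mat (X \<cdot>\<^sub>m (C * N)) (0\<^sub>m n 1) (0\<^sub>m 1 n) (mat 1 1 (\<lambda>_. X * char_poly A))"
    unfolding core_def core_adj_def
    by (subst mult_four_block_mat[of _ n n _ 1 _ 1 _ _ n _ 1])
       (use C_carrier col in \<open>auto simp: mult_smult_distrib[of _ n n _ n] intro!: cong_four_block_mat eq_matI simp: scalar_prod_def\<close>)
  also have "\<dots> = (X * char_poly A) \<cdot>\<^sub>m 1\<^sub>m (Suc n)"
    unfolding CN by (rule eq_matI) auto
  finally show ?thesis .
qed

private lemma adj_bordered: "adj_mat (char_poly_matrix B) = shear a * core_adj * shear (- a)"
proof (rule adj_mat_unique[symmetric])
  show c: "char_poly_matrix B \<in> carrier_mat (Suc n) (Suc n)" using bordered_mat_carrier by simp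
  show "shear a * core_adj * shear (- a) \<in> carrier_mat (Suc n) (Suc n)"
    using shear_carrier core_carrier by (meson mult_carrier_mat)
  have d: "det (char_poly_matrix B) = X * char_poly A" using char_poly_bordered_mat by (simp add: char_poly_def)
  show "det (char_poly_matrix B) \<noteq> 0"
    unfolding d using degree_monic_char_poly[OF A] by auto
  have inv: "shear (- a) * shear a = 1\<^sub>m (Suc n)" using shear_inverse[of "- a"] by simp
  note [simp] = shear_carrier core_carrier
  have m: "P * Q \<in> carrier_mat (Suc n) (Suc n)"
    if "P \<in> carrier_mat (Suc n) (Suc n)" "Q \<in> carrier_mat (Suc n) (Suc n)" for P Q :: "real poly mat"
    using that by (rule mult_carrier_mat)
  note assoc = assoc_mult_mat[of _ "Suc n" "Suc n" _ "Suc n" _ "Suc n"]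
  have "char_poly_matrix B * (shear a * core_adj * shear (- a))
      = shear a * (core * ((shear (- a) * shear a) * (core_adj * shear (- a))))"
    unfolding char_poly_matrix_bordered by (simp add: assoc m)
  also have "\<dots> = shear a * ((core * core_adj) * shear (- a))"
    unfolding inv by (simp add: assoc m left_mult_one_mat[of _ "Suc n" "Suc n"])
  also have "\<dots> = (X * char_poly A) \<cdot>\<^sub>m (shear a * shear (- a))"
    unfolding core_mult_core_adj
    by (simp add: mult_smult_assoc_mat[of _ "Suc n" "Suc n" _ "Suc n"] mult_smult_distrib[of _ "Suc n" "Suc n" _ "Suc n"]
        left_mult_one_mat[of _ "Suc n" "Suc n"])
  finally show "char_poly_matrix B * (shear a * core_adj * shear (- a)) = det (char_poly_matrix B) \<cdot>\<^sub>m 1\<^sub>m (Suc n)"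
    unfolding d shear_inverse .
qed

private lemma char_cofactor_adj:
  assumes "M \<in> carrier_mat m m" "i < m" "j < m"
  shows "char_cofactor M (i, j) = adj_mat (char_poly_matrix M) $$ (j, i)"
  using assms(2,3) carrier_matD[OF char_poly_matrix_closed[OF assms(1)]] by (auto simp: char_cofactor_def adj_mat_def)

text \<open>Read off from the adjugate \<open>shear a * core_adj * shear (- a)\<close>. Recall that the adjugate has the
  cofactor at \<open>(i, j)\<close> in its entry \<open>(j, i)\<close>.\<close>
lemma char_cofactor_bordered_mat:
  shows "i < n \<Longrightarrow> j < n \<Longrightarrow> char_cofactor B (i, j) =
      X * char_cofactor A (i, j) - (if i = k then smult a (char_cofactor A (k, j)) else 0)"
    and "j < n \<Longrightarrow> char_cofactor B (n, j) = char_cofactor A (k, j)"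
    and "char_cofactor B (n, n) = smult a (char_cofactor A (k, k)) + char_poly A"
    and "char_cofactor B (k, n) = smult a (X * char_cofactor A (k, k) - char_cofactor B (n, n))"
proof -
  have Y: "shear a * core_adj * shear (- a) = four_block_mat
     (X \<cdot>\<^sub>m N + mat n n (\<lambda>(i, j). if j = k then smult (- a) (N $$ (i, k)) else 0))
     (mat n 1 (\<lambda>(i, _). N $$ (i, k)))
     (mat 1 n (\<lambda>(_, j). smult a (X * N $$ (k, j))
        - (if j = k then smult a (smult a (N $$ (k, k)) + char_poly A) else 0)))
     (mat 1 1 (\<lambda>_. smult a (N $$ (k, k)) + char_poly A))"
    using C_carrier k unfolding core_adj_def
    by (subst shear_mult_four_block, (auto)[4], subst four_block_mult_shear)
       (auto intro!: cong_four_block_mat eq_matI)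
  note entry = char_cofactor_adj[OF bordered_mat_carrier, unfolded adj_bordered Y]
  note [simp] = char_cofactor_adj[OF A]
  show "i < n \<Longrightarrow> j < n \<Longrightarrow> char_cofactor B (i, j) =
      X * char_cofactor A (i, j) - (if i = k then smult a (char_cofactor A (k, j)) else 0)"
    using C_carrier k by (simp add: entry)
  show "j < n \<Longrightarrow> char_cofactor B (n, j) = char_cofactor A (k, j)"
    using C_carrier k by (simp add: entry)
  show nn: "char_cofactor B (n, n) = smult a (char_cofactor A (k, k)) + char_poly A"
    using C_carrier k by (simp add: entry)
  show "char_cofactor B (k, n) = smult a (X * char_cofactor A (k, k) - char_cofactor B (n, n))"
    unfolding nn using C_carrier k by (simp add: entry smult_diff_right)
qed

end

lemma cofactor_combination_closed:
  "p \<in> nonzero_positions A \<Longrightarrow> char_cofactor A p \<in> range (cofactor_combination A)"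
  "r \<in> range (cofactor_combination A) \<Longrightarrow> smult c r \<in> range (cofactor_combination A)"
  "r \<in> range (cofactor_combination A) \<Longrightarrow> s \<in> range (cofactor_combination A) \<Longrightarrow> r + s \<in> range (cofactor_combination A)"
proof -
  assume "p \<in> nonzero_positions A"
  then have "char_cofactor A p = cofactor_combination A (\<lambda>q. if q = p then 1 else 0)"
    by (simp add: cofactor_combination_def if_distrib[of "\<lambda>c. smult c _"] sum.delta cong: if_cong)
  then show "char_cofactor A p \<in> range (cofactor_combination A)" by blast
next
  assume "r \<in> range (cofactor_combination A)"
  then obtain h where "r = cofactor_combination A h" by blast
  then have "smult c r = cofactor_combination A (\<lambda>p. c * h p)"
    by (simp add: cofactor_combination_def smult_sum2)
  then show "smult c r \<in> range (cofactor_combination A)" by blast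
next
  assume "r \<in> range (cofactor_combination A)" "s \<in> range (cofactor_combination A)"
  then obtain h g where "r = cofactor_combination A h" "s = cofactor_combination A g" by blast
  then have "r + s = cofactor_combination A (\<lambda>p. h p + g p)"
    by (simp add: cofactor_combination_def smult_add_left sum.distrib)
  then show "r + s \<in> range (cofactor_combination A)" by blast
qed

text \<open>At \<open>z = 0\<close> the characteristic matrix is \<open>- A\<close>, and the minor has order \<open>n - 1\<close>.\<close>
lemma poly_char_cofactor_0:
  assumes A: "A \<in> carrier_mat n n" and "i < n" "j < n"
  shows "poly (char_cofactor A (i, j)) 0 = (- 1) ^ (i + j + (n - 1)) * det (mat_delete A i j)"
proof -
  have "poly (det (mat_delete (char_poly_matrix A) i j)) 0 = det ((- 1) \<cdot>\<^sub>m mat_delete A i j)"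
  proof (rule poly_det_cong[of _ "n - 1"])
    fix p q assume "p < n - 1" "q < n - 1"
    then show "poly (mat_delete (char_poly_matrix A) i j $$ (p, q)) 0 = ((- 1) \<cdot>\<^sub>m mat_delete A i j) $$ (p, q)"
      using A assms(2,3) by (simp add: mat_delete_def char_poly_matrix_def)
  qed (use A in \<open>auto simp: mat_delete_def char_poly_matrix_def\<close>)
  then show ?thesis using A by (simp add: char_cofactor_def cofactor_def power_add)
qed

text \<open>The span for \<open>B\<close> contains \<open>z\<close> times each cofactor for \<open>A\<close>: for a position outside row \<open>k\<close> it is the
  cofactor at the same position; for a nondiagonal one in row \<open>k\<close> the superfluous term is a multiple
  of the cofactor in the copy of that row in the last row of \<open>B\<close>; for \<open>(k, k)\<close> combine the two
  cofactors in the last column. With these, every polynomial of degree at most \<open>n\<close> without constant term is reached, and the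
  cofactor at \<open>(n, v)\<close> supplies the constant term.\<close>
lemma cofactors_span_bordered_mat:
  assumes A: "A \<in> carrier_mat n n" and span: "cofactors_span A"
    and kv: "k < n" "v < n" "v \<noteq> k" and a: "A $$ (k, k) \<noteq> 0" "A $$ (k, v) \<noteq> 0"
    and det: "det (mat_delete A k v) \<noteq> 0"
  shows "cofactors_span (bordered_mat A k)"
  unfolding cofactors_span_def
proof (intro allI impI)
  let ?B = "bordered_mat A k" and ?X = "[:0, 1:] :: real poly"
  let ?S = "range (cofactor_combination ?B)"
  have B: "?B \<in> carrier_mat (Suc n) (Suc n)" using bordered_mat_carrier[OF A kv(1)] .
  note entry = bordered_mat_entry[OF A kv(1)]
  note cof = char_cofactor_bordered_mat[OF A kv(1)]
  note closed = cofactor_combination_closed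
  have diff: "s - smult c t \<in> ?S" if "s \<in> ?S" "t \<in> ?S" for s t c
    using closed(3)[OF that(1) closed(2)[OF that(2), of "- c"]] by simp
  have shift: "?X * char_cofactor A p \<in> ?S" if "p \<in> nonzero_positions A" for p
  proof -
    obtain i j where p: "p = (i, j)" "i < n" "j < n" "A $$ (i, j) \<noteq> 0"
      using \<open>p \<in> nonzero_positions A\<close> A by (cases p) (auto simp: nonzero_positions_def)
    consider "i \<noteq> k" | "i = k" "j \<noteq> k" | "i = k" "j = k" by blast
    then show ?thesis
    proof cases
      case 1
      then have "(i, j) \<in> nonzero_positions ?B" using p B entry by (simp add: nonzero_positions_def)
      from closed(1)[OF this] show ?thesis using cof(1)[OF p(2,3)] 1 p(1) by simp
    next
      case 2
      then have "(i, j) \<in> nonzero_positions ?B" "(n, j) \<in> nonzero_positions ?B"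
        using p B entry a by (auto simp: nonzero_positions_def)
      from closed(3)[OF closed(1)[OF this(1)] closed(2)[OF closed(1)[OF this(2)], of "A $$ (k, k)"]]
      show ?thesis using cof(1,2) 2 p by simp
    next
      case 3
      have "(k, n) \<in> nonzero_positions ?B" "(n, n) \<in> nonzero_positions ?B"
        using kv B entry a by (auto simp: nonzero_positions_def)
      from closed(3)[OF closed(2)[OF closed(1)[OF this(1)], of "inverse (A $$ (k, k))"] closed(1)[OF this(2)]]
      show ?thesis using a(1) 3 p(1) unfolding cof(4) by simp
    qed
  qed
  \<comment> \<open>The cofactor of the bordered matrix at \<open>(n, v)\<close> is that of \<open>A\<close> at \<open>(k, v)\<close>, and its
    constant term is a nonzero minor.\<close>
  define N where "N = char_cofactor A (k, v)"
  have "(n, v) \<in> nonzero_positions ?B" using kv a B entry by (simp add: nonzero_positions_def)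
  from closed(1)[OF this] have N: "N \<in> ?S" using cof(2)[OF kv(2)] by (simp add: N_def)
  have N0: "poly N 0 \<noteq> 0" unfolding N_def using poly_char_cofactor_0[OF A kv(1,2)] det by simp
  have degN: "degree N < n" unfolding N_def using degree_char_cofactor[OF A] kv by simp
  fix r :: "real poly" assume "degree r < dim_row ?B"
  then have r: "degree r \<le> n" using B by simp
  define c where "c = poly r 0 / poly N 0"
  have "poly (r - smult c N) 0 = 0" using N0 by (simp add: c_def)
  then obtain s where s: "r - smult c N = ?X * s" by (metis dvdE minus_zero poly_eq_0_iff_dvd)
  have "degree s < n"
  proof (cases "s = 0")
    case False
    then have "degree (?X * s) = Suc (degree s)" by (simp add: degree_mult_eq)
    moreover have "degree (r - smult c N) \<le> n"
      using r degN by (intro degree_diff_le) (auto intro: order_trans[OF degree_smult_le])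
    ultimately show ?thesis using s by simp
  qed (use kv in simp)
  then obtain h where h: "s = cofactor_combination A h" using span A by (auto simp: cofactors_span_def)
  have "?X * s = (\<Sum>p\<in>nonzero_positions A. smult (h p) (?X * char_cofactor A p))"
    unfolding h cofactor_combination_def sum_distrib_left by (simp only: mult_smult_right)
  also have "\<dots> \<in> ?S"
    using finite_nonzero_positions
  proof (rule finite_subset_induct'[OF _ subset_refl])
    show "(\<Sum>p\<in>{}. smult (h p) (?X * char_cofactor A p)) \<in> ?S" using closed(2)[OF N, of 0] by simp
    fix p Q assume p: "p \<in> nonzero_positions A" "finite Q" "p \<notin> Q"
      "(\<Sum>p\<in>Q. smult (h p) (?X * char_cofactor A p)) \<in> ?S"
    show "(\<Sum>p\<in>insert p Q. smult (h p) (?X * char_cofactor A p)) \<in> ?S"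
      unfolding sum.insert[OF p(2,3)] by (rule closed(3)[OF closed(2)[OF shift[OF p(1)]] p(4)])
  qed
  finally have "?X * s + smult c N \<in> ?S" using closed(2,3) N by blast
  then show "r \<in> ?S" using s by (metis diff_add_cancel)
qed

section \<open>Matrices with prescribed characteristic polynomial near a given one\<close>

text \<open>A solution of \<open>\<Phi> y = q\<close> is a fixed point of \<open>G y = y - \<Phi> y + q\<close>, which maps the \<open>\<ell>\<^sup>1\<close> ball \<open>S\<close> into itself and
  halves distances. The ball is compact, so the displacement of \<open>G\<close> has a minimum on it; applying
  \<open>G\<close> to a minimizer halves the displacement, so the minimum is zero. Points are infinite sequences
  that vanish from \<open>N\<close> on because the dimension \<open>N\<close> is an arbitrary number here, not a type.\<close>
lemma near_identity_attains_value:
  fixes \<Phi> :: "(nat \<Rightarrow> real) \<Rightarrow> nat \<Rightarrow> real" and N :: nat and \<rho> :: real and q :: "nat \<Rightarrow> real"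
  defines "S \<equiv> {y. (\<Sum>i<N. \<bar>y i\<bar>) \<le> \<rho> \<and> (\<forall>i\<ge>N. y i = 0)}"
  assumes lip: "\<And>y y'. y \<in> S \<Longrightarrow> y' \<in> S \<Longrightarrow>
      (\<Sum>i<N. \<bar>\<Phi> y i - \<Phi> y' i - (y i - y' i)\<bar>) \<le> 1 / 2 * (\<Sum>i<N. \<bar>y i - y' i\<bar>)"
    and q: "(\<Sum>i<N. \<bar>q i - \<Phi> (\<lambda>_. 0) i\<bar>) \<le> \<rho> / 2"
  shows "\<exists>y\<in>S. \<forall>i<N. \<Phi> y i = q i"
proof -
  have "0 \<le> (\<Sum>i<N. \<bar>q i - \<Phi> (\<lambda>_. 0) i\<bar>)" by (rule sum_nonneg) simp
  with q have "\<rho> \<ge> 0" by linarith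
  then have zero: "(\<lambda>_. 0) \<in> S" by (simp add: S_def)
  define G where "G y i = (if i < N then y i - \<Phi> y i + q i else 0)" for y i
  define \<phi> where "\<phi> y = (\<Sum>i<N. \<bar>G y i - y i\<bar>)" for y
  have G_lip: "(\<Sum>i<N. \<bar>G y i - G y' i\<bar>) \<le> 1 / 2 * (\<Sum>i<N. \<bar>y i - y' i\<bar>)" if "y \<in> S" "y' \<in> S" for y y'
  proof -
    have "(\<Sum>i<N. \<bar>G y i - G y' i\<bar>) = (\<Sum>i<N. \<bar>\<Phi> y i - \<Phi> y' i - (y i - y' i)\<bar>)"
      by (intro sum.cong) (auto simp: G_def)
    then show ?thesis using lip[OF that] by simp
  qed
  have coord: "((\<lambda>x. x i) \<longlongrightarrow> y i) (at y within S)" for y :: "nat \<Rightarrow> real" and i S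
    using continuous_on_product_coordinates[of i, where 'b = real]
    by (metis UNIV_I continuous_on_def tendsto_within_subset top_greatest)
  have "compact S"
  proof -
    let ?K = "\<lambda>i. if i < N then {- \<rho>..\<rho>} else {0}"
    have "compactin (product_topology (\<lambda>i. euclidean) UNIV) (PiE UNIV ?K)"
      unfolding compactin_PiE by (auto simp: compactin_euclidean_iff)
    then have "compact (PiE UNIV ?K)" by (simp add: euclidean_product_topology compactin_euclidean_iff)
    moreover have "closed {y :: nat \<Rightarrow> real. (\<Sum>i<N. \<bar>y i\<bar>) \<le> \<rho>}"
      by (intro closed_Collect_le continuous_intros continuous_on_product_coordinates)
    moreover have "S = PiE UNIV ?K \<inter> {y. (\<Sum>i<N. \<bar>y i\<bar>) \<le> \<rho>}"
    proof -
      have "\<bar>y i\<bar> \<le> \<rho>" if "(\<Sum>i<N. \<bar>y i\<bar>) \<le> \<rho>" "i < N" for y :: "nat \<Rightarrow> real" and i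
        using member_le_sum[of i "{..<N}" "\<lambda>i. \<bar>y i\<bar>"] that by auto
      then have "y i \<in> ?K i" if "y \<in> S" for y i
        using that by (cases "i < N") (force simp: S_def abs_le_iff)+
      moreover have "y i = 0" if "y \<in> PiE UNIV ?K" "i \<ge> N" for y i
        using PiE_mem[OF that(1), of i] that(2) by simp
      ultimately show ?thesis unfolding S_def by auto
    qed
    ultimately show ?thesis by (simp add: compact_Int_closed)
  qed
  moreover have "continuous_on S \<phi>"
    unfolding continuous_on_def
  proof
    fix y assume y: "y \<in> S"
    have bound: "\<bar>\<phi> x - \<phi> y\<bar> \<le> 2 * (\<Sum>i<N. \<bar>x i - y i\<bar>)" if "x \<in> S" for x
    proof -
      have "\<bar>\<phi> x - \<phi> y\<bar> \<le> (\<Sum>i<N. \<bar>\<bar>G x i - x i\<bar> - \<bar>G y i - y i\<bar>\<bar>)"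
        unfolding \<phi>_def sum_subtractf[symmetric] by (rule sum_abs)
      also have "\<dots> \<le> (\<Sum>i<N. \<bar>G x i - G y i\<bar> + \<bar>x i - y i\<bar>)" by (intro sum_mono) linarith
      also have "\<dots> \<le> 2 * (\<Sum>i<N. \<bar>x i - y i\<bar>)"
      proof -
        have "0 \<le> (\<Sum>i<N. \<bar>x i - y i\<bar>)" by (rule sum_nonneg) simp
        with G_lip[OF that y] show ?thesis unfolding sum.distrib by linarith
      qed
      finally show ?thesis .
    qed
    have "((\<lambda>x. 2 * (\<Sum>i<N. \<bar>x i - y i\<bar>)) \<longlongrightarrow> 2 * (\<Sum>i<N. \<bar>y i - y i\<bar>)) (at y within S)"
      by (intro tendsto_intros coord)
    then have "((\<lambda>x. 2 * (\<Sum>i<N. \<bar>x i - y i\<bar>)) \<longlongrightarrow> 0) (at y within S)" by simp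
    then have "((\<lambda>x. \<phi> x - \<phi> y) \<longlongrightarrow> 0) (at y within S)"
      by (rule Lim_null_comparison[rotated]) (use bound in \<open>auto simp: eventually_at_filter\<close>)
    then show "(\<phi> \<longlongrightarrow> \<phi> y) (at y within S)" by (simp add: LIM_zero_iff)
  qed
  ultimately obtain y where y: "y \<in> S" "\<And>x. x \<in> S \<Longrightarrow> \<phi> y \<le> \<phi> x"
    using continuous_attains_inf[of S \<phi>] zero by blast
  have "G y \<in> S"
  proof -
    have "(\<Sum>i<N. \<bar>G y i\<bar>) \<le> (\<Sum>i<N. \<bar>G y i - G (\<lambda>_. 0) i\<bar> + \<bar>G (\<lambda>_. 0) i\<bar>)" by (intro sum_mono) linarith
    also have "\<dots> \<le> 1 / 2 * (\<Sum>i<N. \<bar>y i\<bar>) + (\<Sum>i<N. \<bar>G (\<lambda>_. 0) i\<bar>)"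
      using G_lip[OF y(1) zero] by (simp add: sum.distrib)
    also have "(\<Sum>i<N. \<bar>G (\<lambda>_. 0) i\<bar>) = (\<Sum>i<N. \<bar>q i - \<Phi> (\<lambda>_. 0) i\<bar>)"
      by (intro sum.cong) (auto simp: G_def)
    finally show ?thesis using q y(1) by (auto simp: S_def G_def)
  qed
  then have "\<phi> y \<le> 1 / 2 * \<phi> y" using y(2)[of "G y"] G_lip[OF _ y(1), of "G y"] by (simp add: \<phi>_def)
  then have "\<phi> y \<le> 0" by simp
  then have "\<forall>i<N. \<bar>G y i - y i\<bar> = 0" unfolding \<phi>_def
    by (metis (no_types, lifting) abs_ge_zero antisym finite_lessThan lessThan_iff sum_nonneg sum_nonneg_eq_0_iff)
  then have "\<forall>i<N. \<Phi> y i = q i" by (auto simp: G_def)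
  with y(1) show ?thesis by blast
qed

lemma coeffs_tendsto_det:
  assumes "\<And>w. M w \<in> carrier_mat n n" "L \<in> carrier_mat n n"
    and "\<And>i j. i < n \<Longrightarrow> j < n \<Longrightarrow> coeffs_tendsto (\<lambda>w. M w $$ (i, j)) (L $$ (i, j)) F"
  shows "coeffs_tendsto (\<lambda>w. det (M w)) (det L) F"
  unfolding det_def'[OF assms(1)] det_def'[OF assms(2)]
  using assms(3) permutes_in_image
  by (intro coeffs_tendsto_sum coeffs_tendsto_mult coeffs_tendsto_const coeffs_tendsto_prod) fastforce

lemma coeffs_tendsto_char_poly_matrix:
  assumes "\<And>w. M w \<in> carrier_mat n n" "B \<in> carrier_mat n n" "i < n" "j < n"
    and "((\<lambda>w. M w $$ (i, j)) \<longlongrightarrow> B $$ (i, j)) F"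
  shows "coeffs_tendsto (\<lambda>w. char_poly_matrix (M w) $$ (i, j)) (char_poly_matrix B $$ (i, j)) F"
proof -
  have "char_poly_matrix D $$ (i, j) = [:- D $$ (i, j), if i = j then 1 else 0:]" if "D \<in> carrier_mat n n" for D :: "real mat"
    using that assms(3,4) by (simp add: char_poly_matrix_def)
  then show ?thesis using assms by (auto intro!: coeffs_tendsto_pCons coeffs_tendsto_const tendsto_intros)
qed

lemma coeffs_tendsto_char_poly:
  assumes M: "\<And>w. M w \<in> carrier_mat n n" and B: "B \<in> carrier_mat n n"
    and lim: "\<And>i j. i < n \<Longrightarrow> j < n \<Longrightarrow> ((\<lambda>w. M w $$ (i, j)) \<longlongrightarrow> B $$ (i, j)) F"
  shows "coeffs_tendsto (\<lambda>w. char_poly (M w)) (char_poly B) F"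
  unfolding char_poly_def
  using char_poly_matrix_closed[OF M] char_poly_matrix_closed[OF B] coeffs_tendsto_char_poly_matrix[OF M B _ _ lim]
  by (rule coeffs_tendsto_det)

lemma coeffs_tendsto_char_cofactor:
  assumes M: "\<And>w. M w \<in> carrier_mat n n" and B: "B \<in> carrier_mat n n"
    and lim: "\<And>i j. i < n \<Longrightarrow> j < n \<Longrightarrow> ((\<lambda>w. M w $$ (i, j)) \<longlongrightarrow> B $$ (i, j)) F"
  shows "coeffs_tendsto (\<lambda>w. char_cofactor (M w) p) (char_cofactor B p) F"
  unfolding char_cofactor_def cofactor_def
proof (intro coeffs_tendsto_mult coeffs_tendsto_const coeffs_tendsto_det[of _ "n - 1"])
  fix i j assume "i < n - 1" "j < n - 1"
  then show "coeffs_tendsto (\<lambda>w. mat_delete (char_poly_matrix (M w)) (fst p) (snd p) $$ (i, j))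
      (mat_delete (char_poly_matrix B) (fst p) (snd p) $$ (i, j)) F"
    using coeffs_tendsto_char_poly_matrix[OF M B _ _ lim] carrier_matD[OF char_poly_matrix_closed[OF M]]
      carrier_matD[OF char_poly_matrix_closed[OF B]]
    by (simp add: mat_delete_def)
qed (use carrier_matD[OF char_poly_matrix_closed[OF M]] carrier_matD[OF char_poly_matrix_closed[OF B]]
      in \<open>auto simp: mat_delete_def\<close>)

text \<open>Change the entries from those of \<open>Q w\<close> to those of \<open>P w\<close> one position at a time. The
  characteristic polynomial is affine in each entry, so each step contributes the change of the entry
  times a negated cofactor of an intermediate matrix, and all intermediate matrices tend to \<open>B\<close>. Thus
  the difference quotients converge to the partial derivatives at \<open>B\<close> while both matrices vary.\<close>
lemma char_poly_difference_quotient: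
  assumes P: "\<And>w. P w \<in> carrier_mat n n" and Q: "\<And>w. Q w \<in> carrier_mat n n" and B: "B \<in> carrier_mat n n"
    and limP: "\<And>i j. i < n \<Longrightarrow> j < n \<Longrightarrow> ((\<lambda>w. P w $$ (i, j)) \<longlongrightarrow> B $$ (i, j)) F"
    and limQ: "\<And>i j. i < n \<Longrightarrow> j < n \<Longrightarrow> ((\<lambda>w. Q w $$ (i, j)) \<longlongrightarrow> B $$ (i, j)) F"
  obtains g where
    "\<And>w l. coeff (char_poly (P w)) l - coeff (char_poly (Q w)) l
        = (\<Sum>p\<in>{..<n} \<times> {..<n}. g l p w * (P w $$ p - Q w $$ p))"
    "\<And>l p. p \<in> {..<n} \<times> {..<n} \<Longrightarrow> (g l p \<longlongrightarrow> - coeff (char_cofactor B p) l) F"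
proof -
  define Z where "Z D w = mat n n (\<lambda>p. if p \<in> D then P w $$ p else Q w $$ p)" for D w
  have Z: "Z D w \<in> carrier_mat n n" for D w by (simp add: Z_def)
  have limZ: "((\<lambda>w. Z D w $$ (i, j)) \<longlongrightarrow> B $$ (i, j)) F" if "i < n" "j < n" for D i j
    using limP[OF that] limQ[OF that] that by (cases "(i, j) \<in> D") (simp_all add: Z_def)
  have "\<exists>g. (\<forall>w l. coeff (char_poly (Z D w)) l - coeff (char_poly (Q w)) l
        = (\<Sum>p\<in>D. g l p w * (P w $$ p - Q w $$ p)))
      \<and> (\<forall>l. \<forall>p\<in>D. (g l p \<longlongrightarrow> - coeff (char_cofactor B p) l) F)"
    if "finite D" "D \<subseteq> {..<n} \<times> {..<n}" for D
    using that
  proof (induction D)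
    case empty
    have "Z {} w = Q w" for w using Q[of w] by (auto simp: Z_def)
    then show ?case by simp
  next
    case (insert p D)
    then obtain g where g:
      "\<And>w l. coeff (char_poly (Z D w)) l - coeff (char_poly (Q w)) l = (\<Sum>p\<in>D. g l p w * (P w $$ p - Q w $$ p))"
      "\<And>l p. p \<in> D \<Longrightarrow> (g l p \<longlongrightarrow> - coeff (char_cofactor B p) l) F" by auto
    have p: "fst p < n" "snd p < n" using insert.prems by auto
    have "Z (insert p D) w = update_entry (Z D w) p (P w $$ p)" for w
      by (rule eq_matI) (auto simp: Z_def update_entry_def)
    moreover have "Z D w $$ p = Q w $$ p" for w using p insert.hyps(2) by (cases p) (simp add: Z_def)
    ultimately have step: "char_poly (Z (insert p D) w)
        = char_poly (Z D w) - smult (P w $$ p - Q w $$ p) (char_cofactor (Z D w) p)" for w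
      using char_poly_update_entry[OF Z p] by simp
    define g' where "g' l q w = (if q = p then - coeff (char_cofactor (Z D w) p) l else g l q w)" for l q w
    have "(\<Sum>q\<in>insert p D. g' l q w * (P w $$ q - Q w $$ q))
        = - coeff (char_cofactor (Z D w) p) l * (P w $$ p - Q w $$ p)
          + (\<Sum>q\<in>D. g l q w * (P w $$ q - Q w $$ q))" for l w
      using insert.hyps by (simp add: g'_def) (intro sum.cong, auto)
    then have "coeff (char_poly (Z (insert p D) w)) l - coeff (char_poly (Q w)) l
        = (\<Sum>q\<in>insert p D. g' l q w * (P w $$ q - Q w $$ q))" for w l
      using g(1)[of w l] by (simp add: step algebra_simps)
    moreover have "(g' l q \<longlongrightarrow> - coeff (char_cofactor B q) l) F" if "q \<in> insert p D" for l q
    proof (cases "q = p")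
      case True
      have "coeffs_tendsto (\<lambda>w. char_cofactor (Z D w) p) (char_cofactor B p) F"
        by (rule coeffs_tendsto_char_cofactor[OF Z B limZ])
      then show ?thesis using True unfolding g'_def coeffs_tendsto_def by (auto intro: tendsto_minus)
    next
      case False
      then have "g' l q = g l q" by (auto simp: g'_def fun_eq_iff)
      then show ?thesis using False g(2)[of q l] that by simp
    qed
    ultimately show ?case by blast
  qed
  from this[of "{..<n} \<times> {..<n}"] obtain g where g:
    "\<And>w l. coeff (char_poly (Z ({..<n} \<times> {..<n}) w)) l - coeff (char_poly (Q w)) l
        = (\<Sum>p\<in>{..<n} \<times> {..<n}. g l p w * (P w $$ p - Q w $$ p))"
    "\<And>l p. p \<in> {..<n} \<times> {..<n} \<Longrightarrow> (g l p \<longlongrightarrow> - coeff (char_cofactor B p) l) F"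
    by blast
  have "Z ({..<n} \<times> {..<n}) w = P w" for w using P[of w] by (auto simp: Z_def)
  with g that show thesis by simp
qed

lemma sign_of_eq_iff:
  "sign_of x = SZero \<longleftrightarrow> x = 0" "sign_of x = SPos \<longleftrightarrow> x > 0" "sign_of x = SNeg \<longleftrightarrow> x < 0"
  by (auto simp: sign_of_def)

text \<open>An open mapping argument at \<open>B\<close>. The direction \<open>H j\<close> is supported on the nonzero positions of \<open>B\<close> and
  changes to first order only the coefficient of \<open>z ^ j\<close>; the matrix \<open>E\<close> carries the signs of \<open>T\<close> at the
  positions where \<open>B\<close> vanishes. For a fixed small \<open>d > 0\<close> the map from \<open>y\<close> to the coefficients for
  \<open>B + d E + \<Sum> y\<^sub>j H\<^sub>j\<close> is close to a translation, and the entries of this matrix have the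
  signs prescribed by \<open>T\<close>. The radius of the ball for \<open>y\<close> is chosen before \<open>d\<close>, so that \<open>d\<close> can be
  taken small in comparison.\<close>
lemma char_polys_near_attained_in_superpattern:
  assumes B: "B \<in> carrier_mat n n" and span: "cofactors_span B"
    and T: "superpattern T (sgn_mat B)"
  obtains \<rho> where "\<rho> > 0"
    "\<And>q. monic q \<Longrightarrow> degree q = n \<Longrightarrow> (\<Sum>i<n. \<bar>coeff q i - coeff (char_poly B) i\<bar>) \<le> \<rho> \<Longrightarrow>
      \<exists>M\<in>pattern_class T. char_poly M = q"
proof -
  have T_dim: "dim_row T = n" "dim_col T = n" using T B by (auto simp: superpattern_def sgn_mat_def)
  have T_entry: "T $$ p = sign_of (B $$ p)" if "p \<in> {..<n} \<times> {..<n}" "B $$ p \<noteq> 0" for p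
    using T B that by (cases p) (auto simp: superpattern_def sgn_mat_def sign_of_def split: if_splits)
  have "\<exists>h. - monom 1 j = cofactor_combination B h" if "j < n" for j
  proof -
    have "degree (- monom 1 j :: real poly) < dim_row B" using that B by (simp add: degree_monom_eq)
    then show ?thesis using span unfolding cofactors_span_def by blast
  qed
  then obtain h where h: "\<And>j. j < n \<Longrightarrow> - monom 1 j = cofactor_combination B (h j)" by metis
  define H where "H j p = (if B $$ p = 0 then 0 else h j p)" for j p
  have H: "(\<Sum>p\<in>{..<n} \<times> {..<n}. - coeff (char_cofactor B p) i * H j p) = (if i = j then 1 else 0)"
    if "j < n" for i j
  proof -
    have "(\<Sum>p\<in>{..<n} \<times> {..<n}. - coeff (char_cofactor B p) i * H j p)
        = (\<Sum>p\<in>nonzero_positions B. - coeff (char_cofactor B p) i * H j p)"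
      using B by (intro sum.mono_neutral_right) (auto simp: nonzero_positions_def H_def)
    also have "\<dots> = - coeff (cofactor_combination B (h j)) i"
      unfolding cofactor_combination_def coeff_sum sum_negf[symmetric]
      by (intro sum.cong) (auto simp: nonzero_positions_def H_def)
    also have "\<dots> = (if i = j then 1 else 0)" unfolding h[OF that, symmetric] by auto
    finally show ?thesis .
  qed
  define E :: "nat \<times> nat \<Rightarrow> real" where "E p = (if B $$ p \<noteq> 0 then 0 else (case T $$ p of SZero \<Rightarrow> 0 | SPos \<Rightarrow> 1 | SNeg \<Rightarrow> - 1))" for p
  define M where "M y d = mat n n (\<lambda>p. B $$ p + d * E p + (\<Sum>j<n. y j * H j p))" for y d
  have M: "M y d \<in> carrier_mat n n" for y d by (simp add: M_def)
  have M_entry: "M y d $$ p = B $$ p + d * E p + (\<Sum>j<n. y j * H j p)" if "p \<in> {..<n} \<times> {..<n}" for p y d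
    using that by (auto simp: M_def)

  \<comment> \<open>Two parameter vectors \<open>y\<close>, \<open>y'\<close> and \<open>d\<close> tend to zero together along the filter \<open>F\<close>; all
    smallness conditions hold eventually along \<open>F\<close>, which yields one radius \<open>r\<close> for them.\<close>
  define len :: "(nat \<Rightarrow> real) \<times> (nat \<Rightarrow> real) \<times> real \<Rightarrow> real"
    where "len = (\<lambda>(y, y', d). (\<Sum>j<n. \<bar>y j\<bar>) + (\<Sum>j<n. \<bar>y' j\<bar>) + \<bar>d\<bar>)"
  define F where "F = filtercomap len (nhds 0)"
  have len: "(len \<longlongrightarrow> 0) F" unfolding F_def by (rule filterlim_filtercomap)
  have coord_le: "\<bar>y j\<bar> \<le> (\<Sum>j<n. \<bar>y j\<bar>)" if "j < n" for y :: "nat \<Rightarrow> real" and j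
    using member_le_sum[of j "{..<n}" "\<lambda>j. \<bar>y j\<bar>"] that by simp
  have sum_pos: "(\<Sum>j<n. \<bar>y j\<bar>) \<ge> 0" for y :: "nat \<Rightarrow> real" by (simp add: sum_nonneg)
  have lim_d: "((\<lambda>w. snd (snd w)) \<longlongrightarrow> 0) F"
    using len by (rule Lim_null_comparison[rotated])
      (auto intro!: always_eventually sum_pos add_nonneg_nonneg simp: len_def)
  have lim_y: "((\<lambda>w. fst w j) \<longlongrightarrow> 0) F" and lim_y': "((\<lambda>w. fst (snd w) j) \<longlongrightarrow> 0) F" if "j < n" for j
  proof -
    have "\<bar>fst w j\<bar> \<le> len w" "\<bar>fst (snd w) j\<bar> \<le> len w" for w
      using coord_le[OF that, of "fst w"] coord_le[OF that, of "fst (snd w)"] sum_pos[of "fst w"] sum_pos[of "fst (snd w)"]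
      by (auto simp: len_def split: prod.splits)
    then show "((\<lambda>w. fst w j) \<longlongrightarrow> 0) F" "((\<lambda>w. fst (snd w) j) \<longlongrightarrow> 0) F"
      by (auto intro!: Lim_null_comparison[OF _ len] always_eventually)
  qed
  have limM: "((\<lambda>w. M (Y w) (snd (snd w)) $$ p) \<longlongrightarrow> B $$ p) F"
    if p: "p \<in> {..<n} \<times> {..<n}" and Y: "\<And>j. j < n \<Longrightarrow> ((\<lambda>w. Y w j) \<longlongrightarrow> 0) F" for p and Y :: "_ \<Rightarrow> nat \<Rightarrow> real"
  proof -
    have "((\<lambda>w. M (Y w) (snd (snd w)) $$ p) \<longlongrightarrow> B $$ p + 0 * E p + (\<Sum>j<n. 0 * H j p)) F"
      unfolding M_entry[OF p] by (intro tendsto_intros lim_d) (use Y in auto)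
    then show ?thesis by simp
  qed

  obtain g where g:
    "\<And>w l. coeff (char_poly (M (fst w) (snd (snd w)))) l - coeff (char_poly (M (fst (snd w)) (snd (snd w)))) l
        = (\<Sum>p\<in>{..<n} \<times> {..<n}. g l p w * (M (fst w) (snd (snd w)) $$ p - M (fst (snd w)) (snd (snd w)) $$ p))"
    "\<And>l p. p \<in> {..<n} \<times> {..<n} \<Longrightarrow> (g l p \<longlongrightarrow> - coeff (char_cofactor B p) l) F"
    by (rule char_poly_difference_quotient[of "\<lambda>w. M (fst w) (snd (snd w))" n "\<lambda>w. M (fst (snd w)) (snd (snd w))" B F])
      (use M B limM lim_y lim_y' in auto)
  \<comment> \<open>The matrix \<open>K\<close> is an averaged Jacobian: it maps \<open>y - y'\<close> to the exact change of the
    coefficients and tends to the identity.\<close>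
  define K where "K i j w = (\<Sum>p\<in>{..<n} \<times> {..<n}. g i p w * H j p)" for i j w
  have K: "coeff (char_poly (M y d)) i - coeff (char_poly (M y' d)) i = (\<Sum>j<n. K i j (y, y', d) * (y j - y' j))" for y y' d i
  proof -
    have "coeff (char_poly (M y d)) i - coeff (char_poly (M y' d)) i
        = (\<Sum>p\<in>{..<n} \<times> {..<n}. \<Sum>j<n. g i p (y, y', d) * H j p * (y j - y' j))"
      using g(1)[of "(y, y', d)" i]
      by (simp add: M_entry sum_subtractf[symmetric] sum_distrib_left algebra_simps)
    also have "\<dots> = (\<Sum>j<n. K i j (y, y', d) * (y j - y' j))"
      unfolding K_def sum_distrib_right by (rule sum.swap)
    finally show ?thesis .
  qed
  have lim_K: "(K i j \<longlongrightarrow> (if i = j then 1 else 0)) F" if "j < n" for i j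
    unfolding H[OF that, symmetric] K_def by (intro tendsto_intros g(2))

  have "\<forall>\<^sub>F w in F. \<forall>i\<in>{..<n}. \<forall>j\<in>{..<n}. \<bar>K i j w - (if i = j then 1 else 0)\<bar> < 1 / (2 * n)"
  proof (intro eventually_ball_finite ballI finite_lessThan)
    fix i j assume "i \<in> {..<n}" "j \<in> {..<n}"
    then show "\<forall>\<^sub>F w in F. \<bar>K i j w - (if i = j then 1 else 0)\<bar> < 1 / (2 * n)"
      using tendstoD[OF lim_K[of j i], of "1 / (2 * n)"] by (simp add: dist_real_def)
  qed
  moreover have "\<forall>\<^sub>F w in F. \<forall>p\<in>{..<n} \<times> {..<n}. B $$ p \<noteq> 0 \<longrightarrow>
      sign_of (M (fst w) (snd (snd w)) $$ p) = sign_of (B $$ p)"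
  proof (intro eventually_ball_finite ballI finite_cartesian_product finite_lessThan)
    fix p assume p: "p \<in> {..<n} \<times> {..<n}"
    consider "B $$ p = 0" | "B $$ p > 0" | "B $$ p < 0" by linarith
    then show "\<forall>\<^sub>F w in F. B $$ p \<noteq> 0 \<longrightarrow> sign_of (M (fst w) (snd (snd w)) $$ p) = sign_of (B $$ p)"
    proof cases
      case 2
      have "\<forall>\<^sub>F w in F. M (fst w) (snd (snd w)) $$ p > 0"
        by (rule order_tendstoD(1)[OF limM[OF p lim_y] 2])
      then show ?thesis
        by eventually_elim (use 2 in \<open>simp add: sign_of_def\<close>)
    next
      case 3
      have "\<forall>\<^sub>F w in F. M (fst w) (snd (snd w)) $$ p < 0"
        by (rule order_tendstoD(2)[OF limM[OF p lim_y] 3])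
      then show ?thesis
        by eventually_elim (use 3 in \<open>simp add: sign_of_def\<close>)
    qed simp
  qed
  ultimately have good: "\<forall>\<^sub>F w in F. (\<forall>i\<in>{..<n}. \<forall>j\<in>{..<n}. \<bar>K i j w - (if i = j then 1 else 0)\<bar> < 1 / (2 * n)) \<and>
     (\<forall>p\<in>{..<n} \<times> {..<n}. B $$ p \<noteq> 0 \<longrightarrow> sign_of (M (fst w) (snd (snd w)) $$ p) = sign_of (B $$ p))"
    by (rule eventually_conj)
  have len_nonneg: "len w \<ge> 0" for w
    unfolding len_def by (auto intro!: add_nonneg_nonneg sum_pos split: prod.splits)
  obtain r where "r > 0" and within: "\<And>w. len w < r \<Longrightarrow>
      (\<forall>i\<in>{..<n}. \<forall>j\<in>{..<n}. \<bar>K i j w - (if i = j then 1 else 0)\<bar> < 1 / (2 * n)) \<and>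
      (\<forall>p\<in>{..<n} \<times> {..<n}. B $$ p \<noteq> 0 \<longrightarrow> sign_of (M (fst w) (snd (snd w)) $$ p) = sign_of (B $$ p))"
  proof -
    obtain Q where Q: "eventually Q (nhds 0)" "\<And>w. Q (len w) \<Longrightarrow>
      (\<forall>i\<in>{..<n}. \<forall>j\<in>{..<n}. \<bar>K i j w - (if i = j then 1 else 0)\<bar> < 1 / (2 * n)) \<and>
      (\<forall>p\<in>{..<n} \<times> {..<n}. B $$ p \<noteq> 0 \<longrightarrow> sign_of (M (fst w) (snd (snd w)) $$ p) = sign_of (B $$ p))"
      using good unfolding F_def eventually_filtercomap by blast
    from Q(1) obtain r where "r > 0" "\<And>x. dist x 0 < r \<Longrightarrow> Q x"
      unfolding eventually_nhds_metric by blast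
    then show thesis using Q(2) len_nonneg by (intro that[of r]) (auto simp: dist_real_def)
  qed
  then have r: "r > 0"
    "\<And>w i j. len w < r \<Longrightarrow> i < n \<Longrightarrow> j < n \<Longrightarrow> \<bar>K i j w - (if i = j then 1 else 0)\<bar> < 1 / (2 * n)"
    "\<And>w p. len w < r \<Longrightarrow> p \<in> {..<n} \<times> {..<n} \<Longrightarrow> B $$ p \<noteq> 0 \<Longrightarrow>
      sign_of (M (fst w) (snd (snd w)) $$ p) = sign_of (B $$ p)"
    by (meson lessThan_iff)+
  \<comment> \<open>With this radius, \<open>y\<close>, \<open>y'\<close> and \<open>d\<close> together have length at most \<open>3 R < r\<close>.\<close>
  define R where "R = r / 4"

  have "coeffs_tendsto (\<lambda>d. char_poly (M (\<lambda>_. 0) d)) (char_poly B) (at_right 0)"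
  proof (rule coeffs_tendsto_char_poly[OF M B])
    fix i j assume ij: "i < n" "j < n"
    have "((\<lambda>d. M (\<lambda>_. 0) d $$ (i, j)) \<longlongrightarrow> B $$ (i, j) + 0 * E (i, j) + (\<Sum>l<n. 0 * H l (i, j))) (at_right 0)"
      using ij by (subst M_entry) (auto intro!: tendsto_eq_intros)
    then show "((\<lambda>d. M (\<lambda>_. 0) d $$ (i, j)) \<longlongrightarrow> B $$ (i, j)) (at_right 0)" by simp
  qed
  then have "((\<lambda>d. \<Sum>i<n. \<bar>coeff (char_poly (M (\<lambda>_. 0) d)) i - coeff (char_poly B) i\<bar>)
      \<longlongrightarrow> (\<Sum>i<n. \<bar>coeff (char_poly B) i - coeff (char_poly B) i\<bar>)) (at_right 0)"
    unfolding coeffs_tendsto_def by (intro tendsto_intros) auto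
  then have "\<forall>\<^sub>F d in at_right 0. (\<Sum>i<n. \<bar>coeff (char_poly (M (\<lambda>_. 0) d)) i - coeff (char_poly B) i\<bar>) < R / 4"
    using r(1) by (intro order_tendstoD(2)) (auto simp: R_def)
  moreover have "\<forall>\<^sub>F d in at_right 0. 0 < d \<and> d < R"
    using eventually_at_right_real[of 0 R] r(1) by (auto simp: R_def elim: eventually_mono)
  ultimately have "\<forall>\<^sub>F d in at_right 0. (\<Sum>i<n. \<bar>coeff (char_poly (M (\<lambda>_. 0) d)) i - coeff (char_poly B) i\<bar>) < R / 4
      \<and> 0 < d \<and> d < R" by (rule eventually_conj)
  then obtain d where d: "0 < d" "d < R"
    "(\<Sum>i<n. \<bar>coeff (char_poly (M (\<lambda>_. 0) d)) i - coeff (char_poly B) i\<bar>) < R / 4"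
    using eventually_happens' trivial_limit_at_right_real by blast

  show thesis
  proof (rule that[of "R / 4"])
    show "R / 4 > 0" using r(1) by (simp add: R_def)
    fix q :: "real poly"
    assume q: "monic q" "degree q = n" "(\<Sum>i<n. \<bar>coeff q i - coeff (char_poly B) i\<bar>) \<le> R / 4"
    define \<Phi> where "\<Phi> y i = coeff (char_poly (M y d)) i" for y i
    have "\<exists>y\<in>{y. (\<Sum>i<n. \<bar>y i\<bar>) \<le> R \<and> (\<forall>i\<ge>n. y i = 0)}. \<forall>i<n. \<Phi> y i = coeff q i"
    proof (rule near_identity_attains_value)
      have "(\<Sum>i<n. \<bar>coeff q i - \<Phi> (\<lambda>_. 0) i\<bar>) \<le>
          (\<Sum>i<n. \<bar>coeff q i - coeff (char_poly B) i\<bar> + \<bar>\<Phi> (\<lambda>_. 0) i - coeff (char_poly B) i\<bar>)"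
        by (intro sum_mono) linarith
      then show "(\<Sum>i<n. \<bar>coeff q i - \<Phi> (\<lambda>_. 0) i\<bar>) \<le> R / 2"
        using q(3) d(3) by (simp add: sum.distrib \<Phi>_def)
    next
      fix y y' assume y: "y \<in> {y. (\<Sum>i<n. \<bar>y i\<bar>) \<le> R \<and> (\<forall>i\<ge>n. y i = 0)}"
        "y' \<in> {y. (\<Sum>i<n. \<bar>y i\<bar>) \<le> R \<and> (\<forall>i\<ge>n. y i = 0)}"
      then have small: "len (y, y', d) < r" using d r(1) by (simp add: len_def R_def)
      have "\<bar>\<Phi> y i - \<Phi> y' i - (y i - y' i)\<bar> \<le> (\<Sum>j<n. 1 / (2 * n) * \<bar>y j - y' j\<bar>)" if "i < n" for i
      proof -
        have "\<Phi> y i - \<Phi> y' i - (y i - y' i)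
            = (\<Sum>j<n. (K i j (y, y', d) - (if i = j then 1 else 0)) * (y j - y' j))"
          unfolding \<Phi>_def K using that
          by (simp add: left_diff_distrib sum_subtractf if_distrib[of "\<lambda>x. x * _"] cong: if_cong)
        also have "\<bar>\<dots>\<bar> \<le> (\<Sum>j<n. \<bar>(K i j (y, y', d) - (if i = j then 1 else 0)) * (y j - y' j)\<bar>)" by (rule sum_abs)
        also have "\<dots> \<le> (\<Sum>j<n. 1 / (2 * n) * \<bar>y j - y' j\<bar>)"
          unfolding abs_mult
          by (rule sum_mono, rule mult_right_mono[OF less_imp_le[OF r(2)[OF small that]]]) simp_all
        finally show ?thesis .
      qed
      then have "(\<Sum>i<n. \<bar>\<Phi> y i - \<Phi> y' i - (y i - y' i)\<bar>) \<le> (\<Sum>i<n. \<Sum>j<n. 1 / (2 * n) * \<bar>y j - y' j\<bar>)"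
        by (intro sum_mono) auto
      also have "\<dots> \<le> 1 / 2 * (\<Sum>j<n. \<bar>y j - y' j\<bar>)"
        by (cases "n = 0") (simp_all add: sum_distrib_left[symmetric] sum_divide_distrib[symmetric])
      finally show "(\<Sum>i<n. \<bar>\<Phi> y i - \<Phi> y' i - (y i - y' i)\<bar>) \<le> 1 / 2 * (\<Sum>j<n. \<bar>y j - y' j\<bar>)" .
    qed
    then obtain y where y: "(\<Sum>i<n. \<bar>y i\<bar>) \<le> R" "\<And>i. i < n \<Longrightarrow> \<Phi> y i = coeff q i" by blast
    have "char_poly (M y d) = q"
    proof (rule poly_eqI)
      fix i
      show "coeff (char_poly (M y d)) i = coeff q i"
        using y(2)[of i] degree_monic_char_poly[OF M, of y d] q(1,2)
        by (cases i n rule: linorder_cases) (auto simp: \<Phi>_def coeff_eq_0)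
    qed
    moreover have "sign_of (M y d $$ p) = T $$ p" if p: "p \<in> {..<n} \<times> {..<n}" for p
    proof (cases "B $$ p = 0")
      case True
      then have "M y d $$ p = d * E p" unfolding M_entry[OF p] by (simp add: H_def)
      then show ?thesis using True d(1) by (cases "T $$ p") (auto simp: E_def sign_of_def)
    next
      case False
      have "len (y, \<lambda>_. 0, d) < r" using y(1) d r(1) by (simp add: len_def R_def)
      from r(3)[OF this p False] T_entry[OF p False] show ?thesis by simp
    qed
    then have "M y d \<in> pattern_class T"
      using M[of y d] T_dim by (auto simp: pattern_class_def sign_of_eq_iff[symmetric])
    ultimately show "\<exists>M\<in>pattern_class T. char_poly M = q" by blast
  qed
qed

section \<open>Inertially arbitrary superpatterns\<close>

lemma eigenvalues_eq: "A \<in> carrier_mat n n \<Longrightarrow> eigenvalues A = complex_roots (char_poly A)"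
  by (simp add: eigenvalues_def of_real_hom.char_poly_hom)

text \<open>A polynomial of the wanted inertia is taken so close to the characteristic polynomial of \<open>B\<close> that a
  matrix in the class of \<open>T\<close> realizes it.\<close>
lemma inertially_arbitrary_superpattern:
  assumes B: "B \<in> carrier_mat n n" and "cofactors_span B"
    and imag: "\<And>z. z \<in># eigenvalues B \<Longrightarrow> Re z = 0" and two: "count (eigenvalues B) 0 \<ge> 2"
    and T: "superpattern T (sgn_mat B)"
  shows "inertially_arbitrary T"
proof -
  have dim: "dim_row T = n" "dim_col T = n" using T B by (auto simp: superpattern_def sgn_mat_def)
  have monic: "monic (char_poly B)" "degree (char_poly B) = n" using degree_monic_char_poly[OF B] by auto
  then have nz: "char_poly B \<noteq> 0" by auto
  have "[:0, 1:]\<^sup>2 dvd char_poly B"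
  proof -
    have X2: "[:0, 1:]\<^sup>2 = (monom 1 2 :: 'a :: comm_ring_1 poly)" by (simp add: monom_altdef)
    have "[:- 0, 1:]\<^sup>2 dvd map_poly complex_of_real (char_poly B)"
      unfolding order_divides using two nz unfolding eigenvalues_eq[OF B] by simp
    then have "monom 1 2 dvd map_poly complex_of_real (char_poly B)" by (simp only: minus_zero X2)
    then show ?thesis unfolding X2 by (simp add: monom_1_dvd_iff' coeff_map_poly)
  qed
  have imag': "Re z = 0" if "poly (map_poly complex_of_real (char_poly B)) z = 0" for z
    using that imag[of z] nz unfolding eigenvalues_eq[OF B] by simp
  obtain \<rho> where \<rho>: "\<rho> > 0"
    "\<And>q. monic q \<Longrightarrow> degree q = n \<Longrightarrow> (\<Sum>i<n. \<bar>coeff q i - coeff (char_poly B) i\<bar>) \<le> \<rho> \<Longrightarrow>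
      \<exists>M\<in>pattern_class T. char_poly M = q"
    using char_polys_near_attained_in_superpattern[OF B assms(2) T] by blast
  have "\<exists>M\<in>pattern_class T. inertia M = (a, b, c)" if abc: "a + b + c = n" for a b c
  proof -
    obtain q :: "real \<Rightarrow> real poly" where q: "coeffs_tendsto q (char_poly B) (at_right 0)"
      "\<And>e. e > 0 \<Longrightarrow> monic (q e) \<and> degree (q e) = n \<and> root_inertia (complex_roots (q e)) = (a, b, c)"
      using imaginary_poly_perturbation[OF monic(1) imag' \<open>[:0, 1:]\<^sup>2 dvd char_poly B\<close>, of a b c] abc monic(2) by auto
    have "((\<lambda>e. \<Sum>i<n. \<bar>coeff (q e) i - coeff (char_poly B) i\<bar>)
      \<longlongrightarrow> (\<Sum>i<n. \<bar>coeff (char_poly B) i - coeff (char_poly B) i\<bar>)) (at_right 0)"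
      using q(1) unfolding coeffs_tendsto_def by (intro tendsto_intros) auto
    then have "\<forall>\<^sub>F e in at_right 0. (\<Sum>i<n. \<bar>coeff (q e) i - coeff (char_poly B) i\<bar>) < \<rho>"
      using \<rho>(1) by (intro order_tendstoD(2)) auto
    then have "\<forall>\<^sub>F e in at_right 0. (\<Sum>i<n. \<bar>coeff (q e) i - coeff (char_poly B) i\<bar>) < \<rho> \<and> e > 0"
      by (intro eventually_conj eventually_at_right_less)
    then obtain e where e: "(\<Sum>i<n. \<bar>coeff (q e) i - coeff (char_poly B) i\<bar>) < \<rho>" "e > 0"
      using eventually_happens' trivial_limit_at_right_real by blast
    then obtain M where M: "M \<in> pattern_class T" "char_poly M = q e"
      using \<rho>(2)[of "q e"] q(2)[OF e(2)] by auto
    have carrier: "M \<in> carrier_mat n n" using M(1) dim by (auto simp: pattern_class_def)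
    have "inertia M = (a, b, c)"
      using q(2)[OF e(2)] M(2) unfolding inertia_def eigenvalues_eq[OF carrier] root_inertia_def by simp
    with M(1) show ?thesis by blast
  qed
  then show ?thesis using dim by (simp add: inertially_arbitrary_def)
qed

theorem theorem5p3:
  fixes n k v c1 c2 :: nat and S :: "sign mat" and A B :: "real mat"
  assumes "S \<in> carrier_mat n n"
    and "A \<in> pattern_class S"
    and "refined_inertia A = (0, 0, c1, c2)"
    and "c1 \<ge> 2"
    and "allows_full_rank_jacobian A"
    and "k < n" and "v < n" and "v \<noteq> k"
    and "A $$ (k, k) \<noteq> 0"
    and "A $$ (k, v) \<noteq> 0"
    and "det (mat_delete A k v) \<noteq> 0"
    and "B = bordered_mat A k"
  shows "refined_inertia B = (0, 0, c1 + 1, c2)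
    \<and> allows_full_rank_jacobian B
    \<and> (\<forall>T. superpattern T (sgn_mat B) \<longrightarrow> inertially_arbitrary T)"
proof -
  have A: "A \<in> carrier_mat n n" using assms(1,2) by (auto simp: pattern_class_def)
  have B: "B \<in> carrier_mat (Suc n) (Suc n)" using bordered_mat_carrier[OF A assms(6)] assms(12) by simp
  have "complex_roots [:0, 1:] = {# 0 #}" using complex_roots_linear[of 0] by simp
  moreover have "char_poly A \<noteq> 0" using degree_monic_char_poly[OF A] by auto
  ultimately have "complex_roots ([:0, 1:] * char_poly A) = add_mset 0 (complex_roots (char_poly A))"
    by (subst complex_roots_mult) simp_all
  then have ev: "eigenvalues B = add_mset 0 (eigenvalues A)"
    unfolding eigenvalues_eq[OF A] eigenvalues_eq[OF B] by (simp only: assms(12) char_poly_bordered_mat[OF A assms(6)])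
  have inertia: "refined_inertia B = (0, 0, c1 + 1, c2)"
    using assms(3) by (simp add: refined_inertia_def ev)
  have span: "cofactors_span B"
    using cofactors_span_bordered_mat[OF A _ assms(6-11)] allows_full_rank_jacobian_iff[OF A] assms(5,12) by simp
  have "Re z = 0" if "z \<in># eigenvalues B" for z
  proof -
    have "z \<notin># {# z \<in># eigenvalues B. Re z > 0 #}" "z \<notin># {# z \<in># eigenvalues B. Re z < 0 #}"
      using inertia by (auto simp: refined_inertia_def)
    then show ?thesis using that by (simp add: not_less)
  qed
  moreover have "count (eigenvalues B) 0 \<ge> 2" using inertia assms(4) by (simp add: refined_inertia_def)
  ultimately have "superpattern T (sgn_mat B) \<Longrightarrow> inertially_arbitrary T" for T
    using inertially_arbitrary_superpattern[OF B span] by blast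
  then show ?thesis using inertia span allows_full_rank_jacobian_iff[OF B] by blast
qed

end
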